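(* Let $\Sigma$ be a finite alphabet and let $X\subset \Sigma^{\mathbb{N}}$ be a sofic shift all of whose transitive components are mixing. Then there exists a finite simplicial complex $K$ which is homotopy equivalent to $\tilde X$, where $\tilde X$ carries the Besicovitch topology.
   Context: Subshifts here are one-sided: a subshift is a subset of $\Sigma^{\mathbb{N}}$ that is closed in the product (Cantor) topology and shift-invariant, where the shift is $\sigma(x)_i = x_{i+1}$. A sofic shift is a subshift presented by a finite labeled graph. A subshift is transitive if it is nonempty and for all words $u,v$ occurring in it there is a word $w$ such that $uwv$ occurs in it; a sofic shift is mixing if it is nonempty and there is $m$ such that for all words $u,v$ occurring in it and all $n\ge m$ there is $w$ of length $n$ such that $uwv$ occurs in it. The transitive components of a sofic shift are its maximal (with respect to inclusion) transitive subshifts; there are finitely many. The Besicovitch topology on $\Sigma^{\mathbb{N}}$ is given by the pseudometric $d_B(x,y)=\limsup_{n\to\infty} \frac{1}{n+1}|\{i\in[0,n] : x_i\neq y_i\}|$. For $X \subset \Sigma^{\mathbb{N}}$, $\tilde X = \{z \in \Sigma^{\mathbb{N}} : \exists x \in X,\ d_B(x,z)=0\}$. A simplicial complex is a collection of simplices in a Euclidean space, closed under taking faces, in which any two simplices intersect in a common face; it is identified with the union of its simplices. Two (not necessarily Hausdorff) topological spaces $A,B$ are homotopy equivalent if there are continuous $f:A\to B$, $g:B\to A$ with $g\circ f$ homotopic to $\mathrm{id}_A$ and $f\circ g$ homotopic to $\mathrm{id}_B$. *)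

theory Defs
  imports "HOL-Analysis.Analysis" "HOL-Library.Function_Algebras"
begin

section \<open>One-sided subshifts\<close>

text \<open>The finite alphabet is the universe of a type of class \<open>finite\<close>, with the discrete topology.\<close>

definition shift :: "(nat \<Rightarrow> 'a) \<Rightarrow> nat \<Rightarrow> 'a" where
  "shift x = (\<lambda>i. x (Suc i))"

definition cantor_topology :: "(nat \<Rightarrow> 'a) topology" where
  "cantor_topology = product_topology (\<lambda>_. discrete_topology UNIV) UNIV"

definition subshift :: "(nat \<Rightarrow> 'a) set \<Rightarrow> bool" where
  "subshift X \<longleftrightarrow> closedin cantor_topology X \<and> shift ` X \<subseteq> X"

text \<open>A finite labeled graph is given by its finite set of edges (source, label, target).
  Neither isolated vertices nor parallel edges with the same label affect the presented shift,
  and finitely many vertices can always be named by natural numbers.\<close>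

definition presented_shift :: "('v \<times> 'a \<times> 'v) set \<Rightarrow> (nat \<Rightarrow> 'a) set" where
  "presented_shift E = {x. \<exists>v. \<forall>i. (v i, x i, v (Suc i)) \<in> E}"

definition sofic_shift :: "(nat \<Rightarrow> 'a) set \<Rightarrow> bool" where
  "sofic_shift X \<longleftrightarrow>
     subshift X \<and> (\<exists>E :: (nat \<times> 'a \<times> nat) set. finite E \<and> X = presented_shift E)"

definition words :: "(nat \<Rightarrow> 'a) set \<Rightarrow> 'a list set" where
  "words X = {w. \<exists>x\<in>X. \<exists>i. w = map x [i..<i + length w]}"

definition transitive_subshift :: "(nat \<Rightarrow> 'a) set \<Rightarrow> bool" where
  "transitive_subshift X \<longleftrightarrow>
     subshift X \<and> X \<noteq> {} \<and> (\<forall>u\<in>words X. \<forall>v\<in>words X. \<exists>w. u @ w @ v \<in> words X)"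

definition mixing :: "(nat \<Rightarrow> 'a) set \<Rightarrow> bool" where
  "mixing X \<longleftrightarrow>
     X \<noteq> {} \<and>
     (\<exists>m. \<forall>u\<in>words X. \<forall>v\<in>words X. \<forall>n\<ge>m. \<exists>w. length w = n \<and> u @ w @ v \<in> words X)"

definition transitive_component :: "(nat \<Rightarrow> 'a) set \<Rightarrow> (nat \<Rightarrow> 'a) set \<Rightarrow> bool" where
  "transitive_component X C \<longleftrightarrow>
     C \<subseteq> X \<and> transitive_subshift C \<and>
     (\<forall>D. D \<subseteq> X \<and> transitive_subshift D \<and> C \<subseteq> D \<longrightarrow> D = C)"

section \<open>The Besicovitch topology\<close>

definition besicovitch_dist :: "(nat \<Rightarrow> 'a) \<Rightarrow> (nat \<Rightarrow> 'a) \<Rightarrow> real" where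
  "besicovitch_dist x y =
     real_of_ereal (limsup (\<lambda>n. ereal (real (card {i. i \<le> n \<and> x i \<noteq> y i}) / real (n + 1))))"

text \<open>The limit superior is finite, so the conversion to a real number loses nothing.\<close>

lemma ereal_besicovitch_dist:
  "ereal (besicovitch_dist x y) =
     limsup (\<lambda>n. ereal (real (card {i. i \<le> n \<and> x i \<noteq> y i}) / real (n + 1)))"
proof -
  let ?f = "\<lambda>n. ereal (real (card {i. i \<le> n \<and> x i \<noteq> y i}) / real (n + 1))"
  have "card {i. i \<le> n \<and> x i \<noteq> y i} \<le> n + 1" for n
    using card_mono[of "{..n}" "{i. i \<le> n \<and> x i \<noteq> y i}"] by auto
  then have le: "?f n \<le> 1" for n
    by (auto simp: one_ereal_def divide_simps simp flip: of_nat_Suc)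
  have "0 \<le> liminf ?f"
    by (rule Liminf_bounded) simp
  also have "\<dots> \<le> limsup ?f"
    by (rule Liminf_le_Limsup) simp
  finally have "0 \<le> limsup ?f" .
  moreover have "limsup ?f \<le> 1"
    by (rule Limsup_bounded) (use le in simp)
  ultimately have "\<bar>limsup ?f\<bar> \<noteq> \<infinity>"
    by auto
  then show ?thesis
    unfolding besicovitch_dist_def by (simp add: ereal_real')
qed

text \<open>This is the topology of a pseudometric only, hence not Hausdorff, so that
  \<open>Metric_space.mtopology\<close> does not apply.\<close>

definition besicovitch_topology :: "(nat \<Rightarrow> 'a) topology" where
  "besicovitch_topology =
     topology (\<lambda>U. \<forall>x\<in>U. \<exists>r>0. {y. besicovitch_dist x y < r} \<subseteq> U)"

lemma openin_besicovitch_topology: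
  "openin besicovitch_topology U \<longleftrightarrow> (\<forall>x\<in>U. \<exists>r>0. {y. besicovitch_dist x y < r} \<subseteq> U)"
proof -
  let ?P = "\<lambda>U :: (nat \<Rightarrow> 'a) set. \<forall>x\<in>U. \<exists>r>0. {y. besicovitch_dist x y < r} \<subseteq> U"
  have "istopology ?P"
    unfolding istopology_def
  proof (intro conjI allI impI)
    fix S T assume S: "?P S" and T: "?P T"
    show "?P (S \<inter> T)"
    proof
      fix x assume x: "x \<in> S \<inter> T"
      from S x obtain r where r: "r > 0" "{y. besicovitch_dist x y < r} \<subseteq> S" by blast
      from T x obtain s where s: "s > 0" "{y. besicovitch_dist x y < s} \<subseteq> T" by blast
      show "\<exists>r>0. {y. besicovitch_dist x y < r} \<subseteq> S \<inter> T"
        by (rule exI[of _ "min r s"]) (use r s in auto)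
    qed
  next
    fix \<K> assume K: "\<forall>U\<in>\<K>. ?P U"
    show "?P (\<Union>\<K>)"
    proof
      fix x assume "x \<in> \<Union>\<K>"
      then obtain U where U: "U \<in> \<K>" "x \<in> U" by blast
      with K obtain r where "r > 0" "{y. besicovitch_dist x y < r} \<subseteq> U" by blast
      with U show "\<exists>r>0. {y. besicovitch_dist x y < r} \<subseteq> \<Union>\<K>" by blast
    qed
  qed
  then show ?thesis
    by (simp add: besicovitch_topology_def topology_inverse')
qed

definition besicovitch_saturation :: "(nat \<Rightarrow> 'a) set \<Rightarrow> (nat \<Rightarrow> 'a) set" where
  "besicovitch_saturation X = {z. \<exists>x\<in>X. besicovitch_dist x z = 0}"

section \<open>Simplicial complexes in Euclidean spaces of arbitrary dimension\<close>

text \<open>The dimension of the ambient space has to be existentially quantified, so the type-indexed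
  \<open>simplicial_complex\<close> cannot be used. Instead, following \<open>Euclidean_space\<close>, the n-dimensional
  space consists of the real sequences that vanish from index n on; the pointwise vector space
  structure makes \<open>convex hull\<close>, \<open>affine_dependent\<close> and \<open>face_of\<close> available there.\<close>

instantiation "fun" :: (type, real_vector) real_vector
begin

definition "c *\<^sub>R f = (\<lambda>x. c *\<^sub>R f x)"

instance
  by standard (simp_all add: scaleR_fun_def fun_eq_iff scaleR_add_right scaleR_add_left)

end

definition euclidean_simplex :: "nat \<Rightarrow> (nat \<Rightarrow> real) set \<Rightarrow> bool" where
  "euclidean_simplex n S \<longleftrightarrow>
     (\<exists>V. V \<subseteq> topspace (Euclidean_space n) \<and> finite V \<and> \<not> affine_dependent V \<and> S = convex hull V)"

text \<open>As in the library, the empty set is a simplex and a face of every simplex; thus disjoint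
  simplices are allowed.\<close>

definition euclidean_simplicial_complex :: "nat \<Rightarrow> (nat \<Rightarrow> real) set set \<Rightarrow> bool" where
  "euclidean_simplicial_complex n K \<longleftrightarrow>
     (\<forall>S\<in>K. euclidean_simplex n S) \<and>
     (\<forall>F S. S \<in> K \<and> F face_of S \<longrightarrow> F \<in> K) \<and>
     (\<forall>S S'. S \<in> K \<and> S' \<in> K \<longrightarrow> (S \<inter> S') face_of S \<and> (S \<inter> S') face_of S')"

definition polyhedron_space :: "nat \<Rightarrow> (nat \<Rightarrow> real) set set \<Rightarrow> (nat \<Rightarrow> real) topology" where
  "polyhedron_space n K = subtopology (Euclidean_space n) (\<Union>K)"

end

theory Submission
  imports Defs "HOL-Library.Discrete_Functions" "HOL-Real_Asymp.Real_Asymp"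
begin

text \<open>Two sequences can be mixed by following one of them on a set of indices of prescribed density
  that consists of long runs. A mixing subshift can glue words together with gaps of bounded length,
  so its Besicovitch saturation is closed under such mixtures, which makes it behave like a convex
  set. The saturation of \<open>X\<close> is the union of the saturations of its finitely many transitive
  components, and an intersection of some of these saturations, if nonempty, is again closed under
  mixtures. Hence the saturation of \<open>X\<close> is homotopy equivalent to the nerve of this cover: distances
  to the components give a map to the nerve, mixtures of chosen points of the intersections
  give a map back, and further mixtures and straight lines give the homotopies. That points near
  several components span a simplex of the nerve follows by compactness from the long
  words that sequences at small Besicovitch distance have in common.\<close>

section \<open>Upper density and the phase function\<close>

text \<open>The obstacle is alignment. A mixture reads each sequence at its own positions, so a
  bridging word must have exactly the length of the gap that it fills; mixing supplies one length
  that serves all pairs of words, whereas transitivity leaves the length uncontrolled. Every change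
  of sequence then costs a bounded number of positions, so the changes must have density zero, while
  the share of each sequence must depend continuously on a parameter. Dyadic blocks reconcile the
  two: up to \<open>n\<close> there are about \<open>log n\<close> blocks with boundedly many
  changes each, and moving a threshold inside the blocks by \<open>d\<close> alters a set of density
  at most \<open>2 * d\<close>. The composite from the nerve to the sequences and back need not
  preserve simplices, since a mixture may lie close to components that its coordinates do not
  mention. Only a lower bound on the new coordinates is available, which is why the homotopy to the
  identity passes through a third self-map lying below both.\<close>

definition upper_density :: "nat set \<Rightarrow> real" where
  "upper_density A = besicovitch_dist (\<lambda>i. i \<in> A) (\<lambda>_. False)"

lemma besicovitch_dist_eq: "besicovitch_dist x y = upper_density {i. x i \<noteq> y i}"
  by (simp add: upper_density_def besicovitch_dist_def)

text \<open>The limsup is evaluated only here; later density estimates count elements of initial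
  segments, with a slack \<open>e\<close> that absorbs lower-order errors.\<close>

lemma upper_density_le_iff:
  "upper_density A \<le> c \<longleftrightarrow>
    (\<forall>e>0. \<forall>\<^sub>F n in sequentially. real (card (A \<inter> {..n})) \<le> (c + e) * real (n + 1))"
proof -
  let ?f = "\<lambda>n. real (card (A \<inter> {..n})) / real (n + 1)"
  have eq: "{i. i \<le> n \<and> (i \<in> A) \<noteq> False} = A \<inter> {..n}" for n
    by auto
  have "ereal (upper_density A) = limsup (\<lambda>n. ereal (?f n))"
    unfolding upper_density_def ereal_besicovitch_dist eq ..
  then have "upper_density A \<le> c \<longleftrightarrow> limsup (\<lambda>n. ereal (?f n)) \<le> ereal c"
    by (metis ereal_less_eq(3))
  also have "\<dots> \<longleftrightarrow> (\<forall>y>ereal c. \<forall>\<^sub>F n in sequentially. ereal (?f n) < y)"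
    by (rule Limsup_le_iff)
  also have "\<dots> \<longleftrightarrow> (\<forall>e>0. \<forall>\<^sub>F n in sequentially. ?f n \<le> c + e)"
  proof safe
    fix e :: real assume *: "\<forall>y>ereal c. \<forall>\<^sub>F n in sequentially. ereal (?f n) < y" "0 < e"
    have "ereal c < ereal (c + e)"
      using *(2) by simp
    with *(1) have "\<forall>\<^sub>F n in sequentially. ereal (?f n) < ereal (c + e)"
      by blast
    then show "\<forall>\<^sub>F n in sequentially. ?f n \<le> c + e"
      by eventually_elim simp
  next
    fix y assume *: "\<forall>e>0. \<forall>\<^sub>F n in sequentially. ?f n \<le> c + e" "ereal c < y"
    then obtain z where z: "ereal c < ereal z" "ereal z < y"
      using ereal_dense2 by blast
    with *(1)[rule_format, of "z - c"] have "\<forall>\<^sub>F n in sequentially. ?f n \<le> z"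
      by simp
    then show "\<forall>\<^sub>F n in sequentially. ereal (?f n) < y"
      by eventually_elim (use z in \<open>metis ereal_less_eq(3) le_less_trans\<close>)
  qed
  also have "\<dots> \<longleftrightarrow> (\<forall>e>0. \<forall>\<^sub>F n in sequentially. real (card (A \<inter> {..n})) \<le> (c + e) * real (n + 1))"
    by (simp add: pos_divide_le_eq)
  finally show ?thesis .
qed

lemma upper_density_leD:
  assumes "upper_density A \<le> c" "0 < e"
  shows "\<forall>\<^sub>F n in sequentially. real (card (A \<inter> {..n})) \<le> (c + e) * real (n + 1)"
  using assms upper_density_le_iff by blast

lemma upper_density_nonneg: "0 \<le> upper_density A"
proof (rule ccontr)
  assume "\<not> 0 \<le> upper_density A"
  then have "\<forall>\<^sub>F n in sequentially.
      real (card (A \<inter> {..n})) \<le> (upper_density A + - upper_density A / 2) * real (n + 1)"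
    by (intro upper_density_leD) auto
  then obtain n where
    "real (card (A \<inter> {..n})) \<le> (upper_density A + - upper_density A / 2) * real (n + 1)"
    by (auto simp: eventually_sequentially)
  also have "\<dots> < 0"
    using \<open>\<not> 0 \<le> upper_density A\<close> by (intro mult_neg_pos) auto
  finally show False by simp
qed

lemma upper_density_le_one: "upper_density A \<le> 1"
  unfolding upper_density_le_iff
proof (intro allI impI always_eventually)
  fix e :: real and n :: nat assume "0 < e"
  have "card (A \<inter> {..n}) \<le> n + 1"
    using card_mono[of "{..n}" "A \<inter> {..n}"] by auto
  then have "real (card (A \<inter> {..n})) \<le> 1 * real (n + 1)"
    by (metis mult_1 of_nat_le_iff)
  also have "\<dots> \<le> (1 + e) * real (n + 1)"
    using \<open>0 < e\<close> by (intro mult_right_mono) auto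
  finally show "real (card (A \<inter> {..n})) \<le> (1 + e) * real (n + 1)" .
qed

lemma upper_density_mono_card:
  assumes "\<And>n. card (A \<inter> {..n}) \<le> card (B \<inter> {..n})"
  shows "upper_density A \<le> upper_density B"
  unfolding upper_density_le_iff
proof (intro allI impI)
  fix e :: real assume "0 < e"
  from upper_density_leD[OF order_refl this, of B]
  show "\<forall>\<^sub>F n in sequentially. real (card (A \<inter> {..n})) \<le> (upper_density B + e) * real (n + 1)"
    by eventually_elim (use assms of_nat_mono order_trans in blast)
qed

lemma upper_density_mono: "A \<subseteq> B \<Longrightarrow> upper_density A \<le> upper_density B"
  by (intro upper_density_mono_card card_mono) auto

lemma upper_density_empty [simp]: "upper_density {} = 0"
proof (rule antisym[OF _ upper_density_nonneg])
  show "upper_density {} \<le> 0"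
    by (simp add: upper_density_le_iff)
qed

lemma upper_density_Un: "upper_density (A \<union> B) \<le> upper_density A + upper_density B"
  unfolding upper_density_le_iff
proof (intro allI impI)
  fix e :: real assume "0 < e"
  then have "0 < e / 2" by simp
  from upper_density_leD[OF order_refl this, of A] upper_density_leD[OF order_refl this, of B]
  show "\<forall>\<^sub>F n in sequentially.
    real (card ((A \<union> B) \<inter> {..n})) \<le> (upper_density A + upper_density B + e) * real (n + 1)"
  proof eventually_elim
    case (elim n)
    have "card ((A \<union> B) \<inter> {..n}) \<le> card (A \<inter> {..n}) + card (B \<inter> {..n})"
      by (simp add: Int_Un_distrib2 card_Un_le)
    then have "real (card ((A \<union> B) \<inter> {..n})) \<le> real (card (A \<inter> {..n})) + real (card (B \<inter> {..n}))"
      by linarith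
    also have "\<dots> \<le> (upper_density A + e / 2) * real (n + 1) + (upper_density B + e / 2) * real (n + 1)"
      using elim by linarith
    also have "\<dots> = (upper_density A + upper_density B + e) * real (n + 1)"
      by (simp add: algebra_simps)
    finally show ?case .
  qed
qed

lemma upper_density_le_Un:
  assumes "A \<subseteq> B \<union> C"
  shows "upper_density A \<le> upper_density B + upper_density C"
  using upper_density_mono[OF assms] upper_density_Un[of B C] by linarith

lemma upper_density_UN:
  assumes "finite I"
  shows "upper_density (\<Union>i\<in>I. A i) \<le> (\<Sum>i\<in>I. upper_density (A i))"
  using assms
proof (induction I)
  case (insert j I)
  then show ?case
    using upper_density_Un[of "A j" "\<Union>i\<in>I. A i"] by simp
qed simp

lemma upper_density_zero_mono: "upper_density B = 0 \<Longrightarrow> A \<subseteq> B \<Longrightarrow> upper_density A = 0"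
  using upper_density_mono[of A B] upper_density_nonneg[of A] by simp

lemma upper_density_zero_UN:
  assumes "finite I" "\<And>i. i \<in> I \<Longrightarrow> upper_density (A i) = 0"
  shows "upper_density (\<Union>i\<in>I. A i) = 0"
  using upper_density_UN[OF assms(1), of A] assms(2) upper_density_nonneg[of "\<Union>i\<in>I. A i"]
  by simp

lemma upper_density_shift: "upper_density ((\<lambda>i. i + j) ` A) \<le> upper_density A"
proof (rule upper_density_mono_card)
  fix n
  have "(\<lambda>i. i + j) ` A \<inter> {..n} \<subseteq> (\<lambda>i. i + j) ` (A \<inter> {..n})"
    by auto
  then have "card ((\<lambda>i. i + j) ` A \<inter> {..n}) \<le> card ((\<lambda>i. i + j) ` (A \<inter> {..n}))"
    by (intro card_mono) auto
  also have "\<dots> \<le> card (A \<inter> {..n})"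
    by (rule card_image_le) simp
  finally show "card ((\<lambda>i. i + j) ` A \<inter> {..n}) \<le> card (A \<inter> {..n})" .
qed

lemma besicovitch_dist_nonneg: "0 \<le> besicovitch_dist x y"
  by (simp add: besicovitch_dist_eq upper_density_nonneg)

lemma besicovitch_dist_le_one: "besicovitch_dist x y \<le> 1"
  by (simp add: besicovitch_dist_eq upper_density_le_one)

lemma besicovitch_dist_refl [simp]: "besicovitch_dist x x = 0"
  by (simp add: besicovitch_dist_eq)

lemma besicovitch_dist_commute: "besicovitch_dist x y = besicovitch_dist y x"
  by (simp add: besicovitch_dist_eq eq_commute)

lemma besicovitch_dist_triangle:
  "besicovitch_dist x z \<le> besicovitch_dist x y + besicovitch_dist y z"
  unfolding besicovitch_dist_eq by (rule upper_density_le_Un) auto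

lemma mem_saturation: "z \<in> besicovitch_saturation X \<longleftrightarrow> (\<exists>x\<in>X. besicovitch_dist x z = 0)"
  by (simp add: besicovitch_saturation_def)

lemma subset_saturation: "X \<subseteq> besicovitch_saturation X"
  by (force simp: mem_saturation)

text \<open>The phase runs once through the unit interval on each dyadic block of indices.\<close>

definition phase :: "nat \<Rightarrow> real" where
  "phase i = real (i + 1) / 2 ^ floor_log (i + 1) - 1"

lemma phase_nonneg: "0 \<le> phase i" and phase_less_one: "phase i < 1"
proof -
  have "2 ^ floor_log (i + 1) \<le> i + 1"
    by (rule floor_log_exp2_le) simp
  then have "real (2 ^ floor_log (i + 1)) \<le> real (i + 1)"
    by (rule of_nat_mono)
  then show "0 \<le> phase i" by (simp add: phase_def)
  have "i + 1 < 2 * 2 ^ floor_log (i + 1)"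
    by (rule floor_log_exp2_gt)
  then have "real (i + 1) < real (2 * 2 ^ floor_log (i + 1))"
    by (rule of_nat_less_iff[THEN iffD2])
  then show "phase i < 1" by (simp add: phase_def divide_less_eq)
qed

lemma floor_log_eventually_small:
  assumes "0 < e"
  shows "\<forall>\<^sub>F n in sequentially. K * (real (floor_log (n + 1)) + 1) \<le> e * real (n + 1)"
proof -
  have "\<forall>\<^sub>F n in sequentially. \<bar>K\<bar> * (log 2 (real (n + 1)) + 1) \<le> e * real (n + 1)"
    using assms by real_asymp
  then show ?thesis
  proof eventually_elim
    case (elim n)
    have "real (floor_log (n + 1)) \<le> log 2 (real (n + 1))"
      by (simp add: floor_log_altdef)
    then have "K * (real (floor_log (n + 1)) + 1) \<le> \<bar>K\<bar> * (log 2 (real (n + 1)) + 1)"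
      by (intro mult_mono) auto
    with elim show ?case by linarith
  qed
qed

text \<open>Up to \<open>n\<close> there are \<open>floor_log (n + 1) + 1\<close> dyadic blocks, so
  a bounded error in each block does not affect the density.\<close>

lemma upper_density_leI_floor_log:
  assumes "\<And>n. real (card (A \<inter> {..n})) \<le> c * real (n + 1) + K * (real (floor_log (n + 1)) + 1)"
  shows "upper_density A \<le> c"
  unfolding upper_density_le_iff
proof (intro allI impI)
  fix e :: real assume "0 < e"
  from floor_log_eventually_small[OF this, of K]
  show "\<forall>\<^sub>F n in sequentially. real (card (A \<inter> {..n})) \<le> (c + e) * real (n + 1)"
  proof eventually_elim
    case (elim n)
    with assms[of n] show ?case by (simp add: algebra_simps)
  qed
qed

lemma card_nat_real_interval:
  fixes x y :: real
  assumes "x \<le> y"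
  shows "finite {i::nat. x \<le> real i \<and> real i < y}"
    "real (card {i::nat. x \<le> real i \<and> real i < y}) \<le> y - x + 1"
proof -
  let ?A = "{i::nat. x \<le> real i \<and> real i < y}"
  have sub: "int ` ?A \<subseteq> {\<lceil>x\<rceil>..<\<lceil>y\<rceil>}"
    by (auto simp: less_ceiling_iff ceiling_le_iff)
  then have "finite (int ` ?A)"
    by (rule finite_subset) simp
  then show "finite ?A"
    by (rule finite_imageD) simp
  have "card ?A = card (int ` ?A)"
    by (simp add: card_image)
  also have "\<dots> \<le> card {\<lceil>x\<rceil>..<\<lceil>y\<rceil>}"
    by (rule card_mono[OF _ sub]) simp
  finally have "card ?A \<le> nat (\<lceil>y\<rceil> - \<lceil>x\<rceil>)" by simp
  moreover have "\<lceil>x\<rceil> \<le> \<lceil>y\<rceil>" using assms by (rule ceiling_mono)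
  ultimately have "real (card ?A) \<le> real_of_int (\<lceil>y\<rceil> - \<lceil>x\<rceil>)"
    by linarith
  then show "real (card ?A) \<le> y - x + 1" by linarith
qed

text \<open>In block \<open>l\<close> the condition cuts out a real interval of length
  \<open>2 ^ l * (b - a)\<close>, up to one index of rounding. The factor 2 arises because the last
  block is counted in full even if \<open>n\<close> lies near its start. This Lipschitz bound makes
  mixtures continuous in their thresholds.\<close>

lemma phase_interval_density:
  assumes "a \<le> b"
  shows "upper_density {i. a \<le> phase i \<and> phase i < b} \<le> 2 * (b - a)"
proof (rule upper_density_leI_floor_log[where K = 1])
  fix n
  define L where "L = floor_log (n + 1)"
  define A where "A l = {i::nat. 2 ^ l * (1 + a) \<le> real i \<and> real i < 2 ^ l * (1 + b)}" for l
  have le: "2 ^ l * (1 + a) \<le> 2 ^ l * (1 + b)" for l :: nat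
    using assms by (intro mult_left_mono) auto
  \<comment> \<open>Passing to \<open>Suc i\<close> turns block \<open>l\<close> into the integers
    from \<open>2 ^ l\<close> to \<open>2 ^ (l + 1) - 1\<close>, on which the phase is
    affine.\<close>
  have "Suc ` ({i. a \<le> phase i \<and> phase i < b} \<inter> {..n}) \<subseteq> (\<Union>l\<le>L. A l)"
  proof (rule image_subsetI)
    fix i assume "i \<in> {i. a \<le> phase i \<and> phase i < b} \<inter> {..n}"
    then have i: "a \<le> phase i" "phase i < b" "i \<le> n"
      by auto
    then have "floor_log (i + 1) \<le> L"
      unfolding L_def by (intro floor_log_le_iff) simp
    moreover have "real (Suc i) = 2 ^ floor_log (i + 1) * (1 + phase i)"
      by (simp add: phase_def)
    then have "Suc i \<in> A (floor_log (i + 1))"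
      unfolding A_def mem_Collect_eq using i by (auto intro: mult_left_mono mult_strict_left_mono)
    ultimately show "Suc i \<in> (\<Union>l\<le>L. A l)" by blast
  qed
  then have "card (Suc ` ({i. a \<le> phase i \<and> phase i < b} \<inter> {..n})) \<le> card (\<Union>l\<le>L. A l)"
    by (intro card_mono) (auto simp: A_def card_nat_real_interval(1)[OF le])
  also have "\<dots> \<le> (\<Sum>l\<le>L. card (A l))"
    by (rule card_UN_le) simp
  finally have "real (card ({i. a \<le> phase i \<and> phase i < b} \<inter> {..n})) \<le> (\<Sum>l\<le>L. real (card (A l)))"
    by (simp add: card_image flip: of_nat_sum)
  also have "\<dots> \<le> (\<Sum>l\<le>L. 2 ^ l * (b - a) + 1)"
  proof (rule sum_mono)
    fix l
    show "real (card (A l)) \<le> 2 ^ l * (b - a) + 1"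
      unfolding A_def using card_nat_real_interval(2)[OF le[of l]] by (simp add: algebra_simps)
  qed
  also have "\<dots> = (2 * 2 ^ L - 1) * (b - a) + (real L + 1)"
  proof -
    have "(\<Sum>l\<le>L. (2::real) ^ l) = 2 * 2 ^ L - 1"
      by (induction L) auto
    then show ?thesis
      by (simp add: sum.distrib flip: sum_distrib_right)
  qed
  also have "\<dots> \<le> (2 * real (n + 1)) * (b - a) + (real L + 1)"
  proof -
    have "2 ^ L \<le> n + 1"
      unfolding L_def by (rule floor_log_exp2_le) simp
    then have "real (2 ^ L) \<le> real (n + 1)"
      by (rule of_nat_mono)
    then have "2 * 2 ^ L - 1 \<le> 2 * real (n + 1)"
      by simp
    then show ?thesis using assms by (intro add_right_mono mult_right_mono) auto
  qed
  finally show "real (card ({i. a \<le> phase i \<and> phase i < b} \<inter> {..n}))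
      \<le> 2 * (b - a) * real (n + 1) + 1 * (real (floor_log (n + 1)) + 1)"
    by (simp add: L_def algebra_simps)
qed

text \<open>Inside a block the phase increases, so it passes \<open>a\<close> at most once there and
  at most once more on leaving the block.\<close>

lemma phase_crossing_density: "upper_density {i. (a \<le> phase i) \<noteq> (a \<le> phase (Suc i))} = 0"
proof (rule antisym[OF _ upper_density_nonneg], rule upper_density_leI_floor_log[where K = 2])
  fix n
  define B where "B = {i. (a \<le> phase i) \<noteq> (a \<le> phase (Suc i))}"
  \<comment> \<open>A crossing is determined by its block and by the side of \<open>a\<close> from
    which it starts.\<close>
  let ?h = "\<lambda>i. (floor_log (i + 1), a \<le> phase i)"
  have ne: "?h i \<noteq> ?h j" if "i < j" "i \<in> B" "j \<in> B" for i j
  proof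
    assume eq: "?h i = ?h j"
    have "floor_log (i + 1) \<le> floor_log (Suc i + 1)" "floor_log (Suc i + 1) \<le> floor_log (j + 1)"
      using that by (auto intro!: floor_log_le_iff)
    with eq have "floor_log (Suc i + 1) = floor_log (i + 1)" "floor_log (j + 1) = floor_log (i + 1)"
      by auto
    then have "phase i \<le> phase (Suc i)" "phase (Suc i) \<le> phase j"
      using that by (auto simp: phase_def divide_right_mono)
    with eq that show False by (auto simp: B_def)
  qed
  have "inj_on ?h (B \<inter> {..n})"
    unfolding inj_on_def using ne by (metis IntE linorder_neqE_nat)
  moreover have "?h ` (B \<inter> {..n}) \<subseteq> {..floor_log (n + 1)} \<times> UNIV"
    by (auto intro!: floor_log_le_iff)
  ultimately have "card (B \<inter> {..n}) \<le> card ({..floor_log (n + 1)} \<times> (UNIV :: bool set))"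
    by (intro card_inj_on_le) auto
  then have "card (B \<inter> {..n}) \<le> 2 * (floor_log (n + 1) + 1)"
    by (simp add: card_cartesian_product)
  then have "real (card (B \<inter> {..n})) \<le> real (2 * (floor_log (n + 1) + 1))"
    by (rule of_nat_mono)
  then show "real (card (B \<inter> {..n})) \<le> 0 * real (n + 1) + 2 * (real (floor_log (n + 1)) + 1)"
    by simp
qed

section \<open>The Besicovitch topology and gluing in mixing subshifts\<close>

lemma topspace_besicovitch_topology [simp]: "topspace besicovitch_topology = UNIV"
proof -
  have "openin besicovitch_topology UNIV"
    unfolding openin_besicovitch_topology by (intro ballI exI[of _ 1]) simp
  then show ?thesis
    by (metis openin_subset top.extremum_unique)
qed

lemma openin_besicovitch_ball: "openin besicovitch_topology {y. besicovitch_dist x y < r}"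
  unfolding openin_besicovitch_topology
proof
  fix y assume y: "y \<in> {y. besicovitch_dist x y < r}"
  show "\<exists>s>0. {z. besicovitch_dist y z < s} \<subseteq> {y. besicovitch_dist x y < r}"
  proof (intro exI[of _ "r - besicovitch_dist x y"] conjI subsetI)
    fix z assume "z \<in> {z. besicovitch_dist y z < r - besicovitch_dist x y}"
    then show "z \<in> {y. besicovitch_dist x y < r}"
      using besicovitch_dist_triangle[of x z y] by simp
  qed (use y in simp)
qed

text \<open>A real majorant vanishing at \<open>y0\<close> replaces a metric on the source, so the
  same criterion serves for products with the unit interval.\<close>

lemma continuous_map_into_besicovitch:
  assumes "\<And>y0. y0 \<in> topspace Y \<Longrightarrow> \<exists>\<psi>. continuous_map Y euclideanreal \<psi> \<and> \<psi> y0 = 0 \<and>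
    (\<forall>y\<in>topspace Y. besicovitch_dist (f y0) (f y) \<le> \<psi> y)"
  shows "continuous_map Y besicovitch_topology f"
  unfolding continuous_map_alt
proof (intro conjI allI impI)
  fix U :: "(nat \<Rightarrow> 'b) set" assume U: "openin besicovitch_topology U"
  show "openin Y (f -` U \<inter> topspace Y)"
  proof (subst openin_subopen, intro ballI)
    fix y0 assume y0: "y0 \<in> f -` U \<inter> topspace Y"
    with U obtain r where r: "r > 0" "{y. besicovitch_dist (f y0) y < r} \<subseteq> U"
      by (auto simp: openin_besicovitch_topology)
    obtain \<psi> where \<psi>: "continuous_map Y euclideanreal \<psi>" "\<psi> y0 = 0"
      "\<And>y. y \<in> topspace Y \<Longrightarrow> besicovitch_dist (f y0) (f y) \<le> \<psi> y"
      using assms[of y0] y0 by auto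
    have "openin Y {y \<in> topspace Y. \<psi> y \<in> {..<r}}"
      by (rule openin_continuous_map_preimage[OF \<psi>(1)]) (simp flip: open_openin)
    moreover have "{y \<in> topspace Y. \<psi> y \<in> {..<r}} \<subseteq> f -` U \<inter> topspace Y"
      using \<psi>(3) r(2) by fastforce
    moreover have "y0 \<in> {y \<in> topspace Y. \<psi> y \<in> {..<r}}"
      using y0 r(1) \<psi>(2) by auto
    ultimately show "\<exists>T. openin Y T \<and> y0 \<in> T \<and> T \<subseteq> f -` U \<inter> topspace Y"
      by blast
  qed
qed simp

lemma continuous_map_from_besicovitch:
  assumes "\<And>x y. x \<in> S \<Longrightarrow> y \<in> S \<Longrightarrow> \<bar>\<phi> x - \<phi> y\<bar> \<le> besicovitch_dist x y"
  shows "continuous_map (subtopology besicovitch_topology S) euclideanreal \<phi>"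
  unfolding continuous_map_alt
proof (intro conjI allI impI)
  let ?T = "subtopology besicovitch_topology S"
  fix V :: "real set" assume "openin euclidean V"
  then have V: "open V" by simp
  show "openin ?T (\<phi> -` V \<inter> topspace ?T)"
  proof (subst openin_subopen, intro ballI)
    fix x assume x: "x \<in> \<phi> -` V \<inter> topspace ?T"
    then obtain e where e: "e > 0" "ball (\<phi> x) e \<subseteq> V"
      using openE[OF V, of "\<phi> x"] by blast
    have "openin ?T ({y. besicovitch_dist x y < e} \<inter> S)"
      by (intro openin_subtopology_Int openin_besicovitch_ball)
    moreover have "{y. besicovitch_dist x y < e} \<inter> S \<subseteq> \<phi> -` V \<inter> topspace ?T"
    proof
      fix y assume y: "y \<in> {y. besicovitch_dist x y < e} \<inter> S"
      with assms[of x y] x have "\<phi> y \<in> ball (\<phi> x) e"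
        by (auto simp: dist_real_def)
      with y e(2) show "y \<in> \<phi> -` V \<inter> topspace ?T" by auto
    qed
    ultimately show "\<exists>T. openin ?T T \<and> x \<in> T \<and> T \<subseteq> \<phi> -` V \<inter> topspace ?T"
      using x e(1) by (intro exI[of _ "{y. besicovitch_dist x y < e} \<inter> S"]) auto
  qed
qed simp

lemma continuous_map_besicovitch_dist:
  "continuous_map (subtopology besicovitch_topology S) euclideanreal (besicovitch_dist x)"
proof (rule continuous_map_from_besicovitch)
  fix y z
  show "\<bar>besicovitch_dist x y - besicovitch_dist x z\<bar> \<le> besicovitch_dist y z"
    using besicovitch_dist_triangle[of x y z] besicovitch_dist_triangle[of x z y]
    by (simp add: besicovitch_dist_commute[of z y])
qed

section \<open>Distance to a set\<close>

definition besicovitch_setdist :: "(nat \<Rightarrow> 'a) \<Rightarrow> (nat \<Rightarrow> 'a) set \<Rightarrow> real" where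
  "besicovitch_setdist x A = (INF y\<in>A. besicovitch_dist x y)"

lemma besicovitch_setdist_le: "y \<in> A \<Longrightarrow> besicovitch_setdist x A \<le> besicovitch_dist x y"
  unfolding besicovitch_setdist_def
  by (rule cINF_lower) (auto intro!: bdd_belowI[of _ 0] besicovitch_dist_nonneg)

lemma besicovitch_setdist_nonneg: "A \<noteq> {} \<Longrightarrow> 0 \<le> besicovitch_setdist x A"
  unfolding besicovitch_setdist_def by (rule cINF_greatest) (auto intro: besicovitch_dist_nonneg)

lemma besicovitch_setdist_lessE:
  assumes "A \<noteq> {}" "besicovitch_setdist x A < r"
  obtains y where "y \<in> A" "besicovitch_dist x y < r"
  using assms unfolding besicovitch_setdist_def
  by (subst (asm) cINF_less_iff) (auto intro!: bdd_belowI[of _ 0] besicovitch_dist_nonneg)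

lemma besicovitch_setdist_saturation_le:
  assumes "z \<in> besicovitch_saturation A"
  shows "besicovitch_setdist x A \<le> besicovitch_dist x z"
proof -
  obtain y where y: "y \<in> A" "besicovitch_dist y z = 0"
    using assms by (auto simp: mem_saturation)
  then show ?thesis
    using besicovitch_setdist_le[of y A x] besicovitch_dist_triangle[of x y z]
      besicovitch_dist_commute[of z y] by simp
qed

lemma besicovitch_setdist_triangle:
  assumes "A \<noteq> {}"
  shows "besicovitch_setdist x A \<le> besicovitch_dist x y + besicovitch_setdist y A"
proof -
  have "besicovitch_setdist x A - besicovitch_dist x y \<le> besicovitch_setdist y A"
    unfolding besicovitch_setdist_def[of y]
  proof (rule cINF_greatest[OF assms])
    fix z assume "z \<in> A"
    from besicovitch_setdist_le[OF this, of x] besicovitch_dist_triangle[of x z y]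
    show "besicovitch_setdist x A - besicovitch_dist x y \<le> besicovitch_dist y z" by simp
  qed
  then show ?thesis by simp
qed

lemma continuous_map_besicovitch_setdist:
  assumes "A \<noteq> {}"
  shows "continuous_map (subtopology besicovitch_topology S) euclideanreal
    (\<lambda>x. besicovitch_setdist x A)"
proof (rule continuous_map_from_besicovitch)
  fix x y
  show "\<bar>besicovitch_setdist x A - besicovitch_setdist y A\<bar> \<le> besicovitch_dist x y"
    using besicovitch_setdist_triangle[OF assms, of x y]
      besicovitch_setdist_triangle[OF assms, of y x]
    by (simp add: besicovitch_dist_commute[of y x])
qed

section \<open>Closed sets, compactness and words in the Cantor space\<close>

lemma closedin_cantor_iff:
  "closedin cantor_topology C \<longleftrightarrow> (\<forall>y. (\<forall>n. \<exists>x\<in>C. \<forall>i<n. x i = y i) \<longrightarrow> y \<in> C)"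
proof -
  have top: "topspace (cantor_topology :: (nat \<Rightarrow> 'a) topology) = UNIV"
    by (simp add: cantor_topology_def)
  have "openin cantor_topology (- C) \<longleftrightarrow> (\<forall>y\<in>-C. \<exists>n. \<forall>x. (\<forall>i<n. x i = y i) \<longrightarrow> x \<in> - C)"
    unfolding cantor_topology_def openin_product_topology_alt
  proof (intro ball_cong refl iffI)
    fix y assume "\<exists>U. finite {i \<in> UNIV. U i \<noteq> topspace (discrete_topology UNIV)} \<and>
      (\<forall>i\<in>UNIV. openin (discrete_topology UNIV) (U i)) \<and> y \<in> Pi\<^sub>E UNIV U \<and> Pi\<^sub>E UNIV U \<subseteq> - C"
    then obtain U where U: "finite {i. U i \<noteq> UNIV}" "y \<in> Pi\<^sub>E UNIV U" "Pi\<^sub>E UNIV U \<subseteq> - C"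
      by auto
    from U(1) obtain n where n: "\<And>i. U i \<noteq> UNIV \<Longrightarrow> i < n"
      by (auto simp: finite_nat_iff_bounded)
    show "\<exists>n. \<forall>x. (\<forall>i<n. x i = y i) \<longrightarrow> x \<in> - C"
    proof (intro exI[of _ n] allI impI)
      fix x assume x: "\<forall>i<n. x i = y i"
      have "x i \<in> U i" for i
        by (cases "i < n") (use x n U(2) in \<open>auto simp: PiE_UNIV_domain Pi_def\<close>)
      then show "x \<in> - C" using U(3) by (auto simp: PiE_UNIV_domain)
    qed
  next
    fix y assume "\<exists>n. \<forall>x. (\<forall>i<n. x i = y i) \<longrightarrow> x \<in> - C"
    then obtain n where n: "\<And>x. (\<forall>i<n. x i = y i) \<Longrightarrow> x \<in> - C" by blast
    show "\<exists>U. finite {i \<in> UNIV. U i \<noteq> topspace (discrete_topology UNIV)} \<and>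
      (\<forall>i\<in>UNIV. openin (discrete_topology UNIV) (U i)) \<and> y \<in> Pi\<^sub>E UNIV U \<and> Pi\<^sub>E UNIV U \<subseteq> - C"
    proof (intro exI[of _ "\<lambda>i. if i < n then {y i} else UNIV"] conjI)
      show "finite {i \<in> UNIV. (if i < n then {y i} else UNIV) \<noteq> topspace (discrete_topology UNIV)}"
        by (rule finite_subset[of _ "{..<n}"]) auto
      show "Pi\<^sub>E UNIV (\<lambda>i. if i < n then {y i} else UNIV) \<subseteq> - C"
      proof (intro subsetI n allI impI)
        fix x i assume "x \<in> Pi\<^sub>E UNIV (\<lambda>i. if i < n then {y i} else UNIV)" "i < n"
        then show "x i = y i"
          using PiE_mem[of x UNIV "\<lambda>i. if i < n then {y i} else UNIV" i] by simp
      qed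
    qed auto
  qed
  then have "closedin cantor_topology C \<longleftrightarrow> (\<forall>y\<in>-C. \<exists>n. \<forall>x. (\<forall>i<n. x i = y i) \<longrightarrow> x \<in> - C)"
    by (simp add: closedin_def top Compl_eq_Diff_UNIV)
  also have "\<dots> \<longleftrightarrow> (\<forall>y. (\<forall>n. \<exists>x\<in>C. \<forall>i<n. x i = y i) \<longrightarrow> y \<in> C)" (is "?L \<longleftrightarrow> ?R")
  proof (intro iffI allI ballI impI)
    fix y assume L: ?L and y: "\<forall>n. \<exists>x\<in>C. \<forall>i<n. x i = y i"
    show "y \<in> C"
    proof (rule ccontr)
      assume "y \<notin> C"
      with L obtain n where n: "\<And>x. (\<forall>i<n. x i = y i) \<Longrightarrow> x \<in> - C" by blast
      from y obtain x where "x \<in> C" "\<forall>i<n. x i = y i" by blast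
      with n[of x] show False by simp
    qed
  next
    fix y assume R: ?R and y: "y \<in> - C"
    have "\<not> (\<forall>n. \<exists>x\<in>C. \<forall>i<n. x i = y i)"
      using R[rule_format, of y] y by blast
    then obtain n where "\<not> (\<exists>x\<in>C. \<forall>i<n. x i = y i)" by blast
    then show "\<exists>n. \<forall>x. (\<forall>i<n. x i = y i) \<longrightarrow> x \<in> - C"
      by (intro exI[of _ n]) blast
  qed
  finally show ?thesis .
qed

lemma closedin_cantor_cylinder:
  assumes "closedin cantor_topology C" "\<And>x y. (\<forall>i<n. x i = y i) \<Longrightarrow> P x \<longleftrightarrow> P y"
  shows "closedin cantor_topology {x\<in>C. P x}"
  unfolding closedin_cantor_iff
proof (intro allI impI)
  fix y assume y: "\<forall>n. \<exists>x\<in>{x\<in>C. P x}. \<forall>i<n. x i = y i"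
  then have "y \<in> C"
    using assms(1)[unfolded closedin_cantor_iff, rule_format, of y] by blast
  moreover have "P y"
    using y assms(2) by blast
  ultimately show "y \<in> {x\<in>C. P x}" by simp
qed

lemma cantor_nested:
  fixes A :: "nat \<Rightarrow> (nat \<Rightarrow> 'a::finite) set"
  assumes "\<And>n. closedin cantor_topology (A n)" "\<And>n. A n \<noteq> {}" "decseq A"
  shows "\<exists>x. \<forall>n. x \<in> A n"
proof -
  have "compact_space (cantor_topology :: (nat \<Rightarrow> 'a) topology)"
    by (simp add: cantor_topology_def compact_space_product_topology compact_space_discrete_topology)
  from compact_space_imp_nest[OF this assms] show ?thesis
    by blast
qed

lemma funpow_shift: "(shift ^^ k) x = (\<lambda>i. x (i + k))"
  by (induction k) (auto simp: shift_def)

lemma subshift_shift: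
  assumes "subshift C" "x \<in> C"
  shows "(\<lambda>i. x (i + k)) \<in> C"
proof -
  have "(shift ^^ k) x \<in> C"
    by (induction k) (use assms in \<open>auto simp: subshift_def\<close>)
  then show ?thesis by (simp add: funpow_shift)
qed

text \<open>Shift invariance moves any occurrence of a word to position 0.\<close>

lemma mem_words_iff:
  assumes "subshift C"
  shows "w \<in> words C \<longleftrightarrow> (\<exists>x\<in>C. \<forall>i<length w. w ! i = x i)"
proof
  assume "w \<in> words C"
  then obtain x i where "x \<in> C" "w = map x [i..<i + length w]"
    by (auto simp: words_def)
  then have "\<forall>j<length w. w ! j = x (j + i)"
    by (metis add.commute length_upt nth_map nth_upt add_diff_cancel_left' nat_add_left_cancel_less)
  with subshift_shift[OF assms \<open>x \<in> C\<close>, of i] show "\<exists>x\<in>C. \<forall>i<length w. w ! i = x i"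
    by (intro bexI[of _ "\<lambda>j. x (j + i)"]) auto
next
  assume "\<exists>x\<in>C. \<forall>i<length w. w ! i = x i"
  then obtain x where "x \<in> C" "\<forall>i<length w. w ! i = x i" by blast
  moreover from this have "w = map x [0..<0 + length w]"
    by (intro nth_equalityI) auto
  ultimately obtain x where "x \<in> C" "w = map x [0..<0 + length w]" by blast
  then show "w \<in> words C"
    unfolding words_def by blast
qed

lemma map_upt_in_words: "x \<in> C \<Longrightarrow> map x [i..<j] \<in> words C"
  unfolding words_def mem_Collect_eq
  by (rule bexI[of _ x], rule exI[of _ i]) (cases "i \<le> j"; simp)+

section \<open>Gluing in mixing subshifts\<close>

text \<open>\<open>c i\<close> tells which of the points \<open>p\<close> is followed at position
  \<open>i\<close>. After each change the next \<open>m\<close> positions are surrendered to a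
  bridging word; as its length is exactly \<open>m\<close>, the next point resumes at its own
  position. The surrendered positions lie in \<open>m\<close> translates of the null set of
  changes.\<close>

lemma mixing_glue:
  fixes p :: "'b \<Rightarrow> nat \<Rightarrow> 'a::finite"
  assumes sub: "subshift C" and mix: "mixing C"
    and p: "\<And>i. p (c i) \<in> C" and breaks: "upper_density {i. c (Suc i) \<noteq> c i} = 0"
  shows "(\<lambda>i. p (c i) i) \<in> besicovitch_saturation C"
proof -
  obtain m where m: "\<And>u v. u \<in> words C \<Longrightarrow> v \<in> words C \<Longrightarrow>
      \<exists>w. length w = m \<and> u @ w @ v \<in> words C"
    using mix unfolding mixing_def by blast
  define B where "B = {i. c (Suc i) \<noteq> c i}"
  \<comment> \<open>A change at \<open>b\<close> takes effect at position \<open>b + 1\<close>, so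
    the surrendered positions are \<open>b + 1\<close> to \<open>b + m\<close>.\<close>
  define good where "good i \<longleftrightarrow> (\<forall>b\<in>B. \<not> (b < i \<and> i \<le> b + m))" for i
  have const: "c i = c s" if "s \<le> i" "\<And>b. s \<le> b \<Longrightarrow> b < i \<Longrightarrow> b \<notin> B" for s i
    using that by (induction i rule: dec_induct) (auto simp: B_def)
  have approx: "\<exists>x\<in>C. \<forall>i<N. good i \<longrightarrow> x i = p (c i) i" for N
  proof (induction N rule: less_induct)
    case (less N)
    \<comment> \<open>The last change that takes effect before \<open>N\<close> splits off a final
      constant run starting at \<open>s\<close>; the induction hypothesis supplies a point for the
      prefix of length \<open>s\<close>.\<close>
    define S where "S = {b\<in>B. Suc b < N}"
    have "finite S"
      by (rule finite_subset[of _ "{..N}"]) (auto simp: S_def)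
    show ?case
    proof (cases "S = {}")
      case True
      then have "c i = c 0" if "i < N" for i
        using that by (intro const) (auto simp: S_def)
      then show ?thesis
        using p[of 0] by metis
    next
      case False
      define b where "b = Max S"
      define s where "s = Suc b"
      have "b \<in> S"
        unfolding b_def using \<open>finite S\<close> False by (rule Max_in)
      then have b: "b \<in> B" "s < N"
        by (auto simp: S_def s_def)
      have bmax: "b' \<le> b" if "b' \<in> S" for b'
        unfolding b_def using \<open>finite S\<close> that by (rule Max_ge)
      have cs: "c i = c s" if "s \<le> i" "i < N" for i
        using that bmax by (intro const) (force simp: S_def s_def)+
      obtain x' where x': "x' \<in> C" "\<And>i. i < s \<Longrightarrow> good i \<Longrightarrow> x' i = p (c i) i"
        using less.IH[OF b(2)] by blast
      have bad: "\<not> good i" if "s \<le> i" "i < s + m" for i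
        using that b by (auto simp: good_def s_def intro!: bexI[of _ b])
      show ?thesis
      \<comment> \<open>A final run of at most \<open>m\<close> positions is entirely surrendered,
        so the point for the prefix already serves.\<close>
      proof (cases "N \<le> s + m")
        case True
        then show ?thesis
          using x' bad by (intro bexI[of _ x']) (meson less_le_trans linorder_not_le)+
      next
        case False
        obtain w where w: "length w = m"
          "map x' [0..<s] @ w @ map (p (c s)) [s+m..<N] \<in> words C"
          using m[OF map_upt_in_words[OF x'(1)] map_upt_in_words[OF p[of s]]] by blast
        let ?u = "map x' [0..<s] @ w @ map (p (c s)) [s+m..<N]"
        have len: "length ?u = N"
          using w(1) False by simp
        with w(2) obtain x where x: "x \<in> C" "\<And>i. i < N \<Longrightarrow> ?u ! i = x i"
          by (auto simp: mem_words_iff[OF sub])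
        have "x i = p (c i) i" if "i < N" "good i" for i
        proof (cases "i < s")
          case True
          then show ?thesis
            using x(2)[OF that(1)] x'(2)[OF True that(2)] by (simp add: nth_append)
        next
          case False
          with bad[of i] that(2) have "s + m \<le> i" by (meson linorder_not_le)
          then obtain d where "i = s + m + d"
            using le_Suc_ex by blast
          then have "?u ! i = p (c s) i"
            using that w(1) by (simp add: nth_append)
          then show ?thesis
            using x(2)[OF that(1)] cs[of i] that False by simp
        qed
        with x(1) show ?thesis by blast
      qed
    qed
  qed
  \<comment> \<open>Each finite prefix is realized by some point of \<open>C\<close>; compactness
    yields a single point for all prefixes.\<close>
  define A where "A N = {x\<in>C. \<forall>i<N. good i \<longrightarrow> x i = p (c i) i}" for N
  have "\<exists>y. \<forall>N. y \<in> A N"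
  proof (rule cantor_nested[of A])
    show "closedin cantor_topology (A N)" for N
      unfolding A_def using sub
      by (intro closedin_cantor_cylinder[where n = N]) (auto simp: subshift_def)
    show "A N \<noteq> {}" for N
      using approx[of N] by (auto simp: A_def)
    show "decseq A"
      by (auto simp: A_def decseq_def)
  qed
  then obtain y where y: "\<And>N. y \<in> A N" by blast
  have "{i. y i \<noteq> p (c i) i} \<subseteq> {i. \<not> good i}"
    using y by (auto simp: A_def)
  also have "\<dots> \<subseteq> (\<Union>j\<in>{1..m}. (\<lambda>i. i + j) ` B)"
  proof
    fix i assume "i \<in> {i. \<not> good i}"
    then obtain b where "b \<in> B" "b < i" "i \<le> b + m"
      by (auto simp: good_def)
    then show "i \<in> (\<Union>j\<in>{1..m}. (\<lambda>i. i + j) ` B)"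
      by (intro UN_I[of "i - b"] image_eqI[of _ _ b]) auto
  qed
  finally have "besicovitch_dist y (\<lambda>i. p (c i) i) = 0"
    unfolding besicovitch_dist_eq
  proof (rule upper_density_zero_mono[rotated], intro upper_density_zero_UN)
    fix j
    show "upper_density ((\<lambda>i. i + j) ` B) = 0"
      using upper_density_shift[of j B] upper_density_nonneg breaks
      by (metis B_def antisym)
  qed simp
  moreover have "y \<in> C"
    using y[of 0] by (simp add: A_def)
  ultimately show ?thesis
    by (auto simp: mem_saturation)
qed

text \<open>Representatives in \<open>C\<close> are glued instead. Since \<open>c\<close> has finite
  range, only finitely many of them occur, and the null sets where they differ from the given points
  have a null union.\<close>

lemma saturation_mix:
  fixes p :: "'b \<Rightarrow> nat \<Rightarrow> 'a::finite"
  assumes sub: "subshift C" and mix: "mixing C" and fin: "finite (range c)"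
    and p: "\<And>i. p (c i) \<in> besicovitch_saturation C"
    and breaks: "upper_density {i. c (Suc i) \<noteq> c i} = 0"
  shows "(\<lambda>i. p (c i) i) \<in> besicovitch_saturation C"
proof -
  have "\<forall>b\<in>range c. \<exists>x\<in>C. besicovitch_dist x (p b) = 0"
    using p by (auto simp: mem_saturation)
  then obtain q where "\<forall>b\<in>range c. q b \<in> C \<and> besicovitch_dist (q b) (p b) = 0"
    by metis
  then have q: "\<And>i. q (c i) \<in> C" "\<And>i. besicovitch_dist (q (c i)) (p (c i)) = 0"
    by blast+
  from mixing_glue[OF sub mix, of q c, OF q(1) breaks] obtain y where
    y: "y \<in> C" "besicovitch_dist y (\<lambda>i. q (c i) i) = 0"
    by (auto simp: mem_saturation)
  have "upper_density (\<Union>b\<in>range c. {i. q b i \<noteq> p b i}) = 0"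
    by (rule upper_density_zero_UN[OF fin]) (use q(2) in \<open>auto simp: besicovitch_dist_eq\<close>)
  then have "besicovitch_dist (\<lambda>i. q (c i) i) (\<lambda>i. p (c i) i) = 0"
    unfolding besicovitch_dist_eq by (rule upper_density_zero_mono) auto
  with y besicovitch_dist_triangle[of y "\<lambda>i. p (c i) i" "\<lambda>i. q (c i) i"]
  have "besicovitch_dist y (\<lambda>i. p (c i) i) = 0"
    using besicovitch_dist_nonneg[of y "\<lambda>i. p (c i) i"] by simp
  with y(1) show ?thesis by (auto simp: mem_saturation)
qed

section \<open>Separation by compactness\<close>

text \<open>If every window of length \<open>Suc n\<close> met \<open>B\<close>, the density would
  be at least \<open>1 / Suc n\<close>. The assumed third of this leaves room for a slack of the
  same size, as \<open>2 / 3 < 1\<close>; \<open>Suc n\<close> keeps the denominators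
  nonzero.\<close>

lemma run_free_of_sparse_set:
  assumes "upper_density B \<le> 1 / (3 * real (Suc n))"
  obtains a where "\<And>j. a \<le> j \<Longrightarrow> j < a + n \<Longrightarrow> j \<notin> B"
proof (rule ccontr)
  let ?L = "Suc n"
  assume "\<not> thesis"
  then have "\<forall>a. \<exists>j\<in>B. a \<le> j \<and> j < a + ?L"
    using that less_Suc_eq by (metis add_Suc_right)
  then have "\<forall>a. \<exists>j. j \<in> B \<and> a * ?L \<le> j \<and> j < a * ?L + ?L"
    by blast
  then obtain h where h: "\<And>a. h a \<in> B" "\<And>a. a * ?L \<le> h a" "\<And>a. h a < a * ?L + ?L"
    by metis
  have div: "h a div ?L = a" for a
    using h(2,3)[of a] by (metis add.commute div_nat_eqI mult.commute mult_Suc)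
  have "\<forall>\<^sub>F N in sequentially.
      real (card (B \<inter> {..N})) \<le> (1 / (3 * real ?L) + 1 / (3 * real ?L)) * real (N + 1)"
    using assms by (rule upper_density_leD) simp
  then obtain M where M: "\<And>N. N \<ge> M \<Longrightarrow>
      real (card (B \<inter> {..N})) \<le> (1 / (3 * real ?L) + 1 / (3 * real ?L)) * real (N + 1)"
    by (auto simp: eventually_sequentially)
  define N where "N = Suc M * ?L - 1"
  have N: "N + 1 = Suc M * ?L" "M \<le> N"
    by (auto simp: N_def)
  have "h ` {..M} \<subseteq> B \<inter> {..N}"
  proof (intro image_subsetI IntI)
    fix a assume "a \<in> {..M}"
    then have "a * ?L \<le> M * ?L"
      by (intro mult_le_mono1) simp
    then have "a * ?L + ?L \<le> Suc M * ?L" by simp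
    then show "h a \<in> {..N}"
      using h(3)[of a] N by auto
  qed (rule h(1))
  moreover have "inj_on h {..M}"
    by (metis div inj_onI)
  ultimately have "card {..M} \<le> card (B \<inter> {..N})"
    by (metis card_inj_on_le finite_Int finite_atMost)
  then have "real (Suc M) \<le> real (card (B \<inter> {..N}))"
    by simp
  also have "\<dots> \<le> (1 / (3 * real ?L) + 1 / (3 * real ?L)) * (real (Suc M) * real ?L)"
    using M[OF N(2)] unfolding N(1) of_nat_mult .
  also have "\<dots> = 2 / 3 * real (Suc M)"
    by (simp add: field_simps del: of_nat_Suc)
  finally show False by simp
qed

text \<open>Otherwise, for every \<open>e\<close>, some sequence is closer than \<open>e\<close> to
  all \<open>C i\<close>. Points of the \<open>C i\<close> near it agree with each other on long
  runs, which shift invariance moves to the origin, and a limit of such points lies in all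
  \<open>C i\<close>.\<close>

lemma disjoint_subshifts_separated:
  fixes C :: "'i \<Rightarrow> (nat \<Rightarrow> 'a::finite) set"
  assumes fin: "finite I" and sub: "\<And>i. i \<in> I \<Longrightarrow> subshift (C i)"
    and ne: "\<And>i. i \<in> I \<Longrightarrow> C i \<noteq> {}" and disj: "(\<Inter>i\<in>I. C i) = {}"
  obtains e where "e > 0" "\<And>x. \<exists>i\<in>I. e \<le> besicovitch_setdist x (C i)"
proof (rule ccontr)
  assume neg: "\<not> thesis"
  have "I \<noteq> {}" using disj by auto
  then obtain i0 where i0: "i0 \<in> I" by blast
  have common: "\<exists>y. \<forall>i\<in>I. y i \<in> C i \<and> (\<forall>j<n. y i j = y i0 j)" for n
  proof -
    \<comment> \<open>The factor \<open>1 / card I\<close> makes the union of the disagreement sets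
      over all \<open>i\<close> as sparse as \<open>run_free_of_sparse_set\<close> requires.\<close>
    let ?e = "1 / (3 * real (Suc n)) / real (card I)"
    have "0 < ?e"
      using fin \<open>I \<noteq> {}\<close> by (simp add: card_gt_0_iff)
    with neg that obtain x where "\<And>i. i \<in> I \<Longrightarrow> besicovitch_setdist x (C i) < ?e"
      by (metis linorder_not_le)
    then have "\<forall>i\<in>I. \<exists>y\<in>C i. besicovitch_dist x y < ?e"
      using ne by (meson besicovitch_setdist_lessE)
    then obtain y where y: "\<And>i. i \<in> I \<Longrightarrow> y i \<in> C i" "\<And>i. i \<in> I \<Longrightarrow> besicovitch_dist x (y i) < ?e"
      by metis
    have "upper_density (\<Union>i\<in>I. {j. x j \<noteq> y i j}) \<le> (\<Sum>i\<in>I. ?e)"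
      using upper_density_UN[OF fin, of "\<lambda>i. {j. x j \<noteq> y i j}"] y(2)
      by (fold besicovitch_dist_eq) (meson less_imp_le order_trans sum_mono)
    also have "\<dots> = 1 / (3 * real (Suc n))"
      using fin \<open>I \<noteq> {}\<close> by simp
    finally obtain a where a: "\<And>j. a \<le> j \<Longrightarrow> j < a + n \<Longrightarrow> j \<notin> (\<Union>i\<in>I. {j. x j \<noteq> y i j})"
      using run_free_of_sparse_set by blast
    show ?thesis
    proof (intro exI[of _ "\<lambda>i j. y i (j + a)"] ballI conjI allI impI)
      fix i assume i: "i \<in> I"
      show "(\<lambda>j. y i (j + a)) \<in> C i"
        using subshift_shift[OF sub[OF i] y(1)[OF i]] .
      fix j assume "j < n"
      then have "j + a \<notin> (\<Union>i\<in>I. {j. x j \<noteq> y i j})"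
        by (intro a) auto
      then have "\<forall>k\<in>I. x (j + a) = y k (j + a)" by blast
      with i i0 show "y i (j + a) = y i0 (j + a)" by metis
    qed
  qed
  \<comment> \<open>Only a prefix of \<open>y\<close> has to extend to a point of each
    \<open>C i\<close>, which is a closed condition; once it holds for all \<open>n\<close>,
    closedness of \<open>C i\<close> gives membership of \<open>y\<close> itself.\<close>
  define A where "A n = {y\<in>C i0. \<forall>i\<in>I. \<exists>y'\<in>C i. \<forall>j<n. y' j = y j}" for n
  have "\<exists>y. \<forall>n. y \<in> A n"
  proof (rule cantor_nested[of A])
    show "closedin cantor_topology (A n)" for n
      unfolding A_def using sub[OF i0]
      by (intro closedin_cantor_cylinder[where n = n]) (auto simp: subshift_def)
    show "A n \<noteq> {}" for n
    proof -
      obtain y where "\<forall>i\<in>I. y i \<in> C i \<and> (\<forall>j<n. y i j = y i0 j)"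
        using common by blast
      then have "y i0 \<in> A n" using i0 unfolding A_def by blast
      then show ?thesis by blast
    qed
    show "decseq A"
      unfolding A_def by (rule decseq_SucI) (blast intro: less_SucI)
  qed
  then obtain y where y: "\<And>n. y \<in> A n" by blast
  have "y \<in> C i" if "i \<in> I" for i
    using sub[OF that] y that unfolding subshift_def closedin_cantor_iff A_def by blast
  with disj show False by blast
qed

section \<open>The nerve of a family of mixing subshifts\<close>

lemma continuous_on_coordinate: "continuous_on S (\<lambda>v :: nat \<Rightarrow> real. v i)"
  by (rule continuous_on_subset[OF continuous_on_product_coordinates]) simp

lemma phase_between_density:
  "upper_density {n. min a b \<le> phase n \<and> phase n < max a b} \<le> 2 * \<bar>a - b\<bar>"
proof -
  have "max a b - min a b = \<bar>a - b\<bar>" by (simp add: max_def min_def)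
  with phase_interval_density[of "min a b" "max a b"] show ?thesis
    by (metis max.cobounded1 min.cobounded1 order_trans)
qed

locale mixing_family =
  fixes C :: "nat \<Rightarrow> (nat \<Rightarrow> 'a::finite) set" and k :: nat
  assumes subshift: "i < k \<Longrightarrow> subshift (C i)"
    and mixing: "i < k \<Longrightarrow> mixing (C i)"
begin

text \<open>For \<open>\<sigma> = {}\<close> the intersection is \<open>UNIV\<close>, so the empty
  simplex always belongs to the nerve, in agreement with the convention for complexes.\<close>

definition nerve :: "nat set set" where
  "nerve = {\<sigma>. \<sigma> \<subseteq> {..<k} \<and> (\<Inter>i\<in>\<sigma>. besicovitch_saturation (C i)) \<noteq> {}}"

text \<open>The nerve is realized with the maximum norm instead of the sum of the coordinates equal to 1,
  so that \<open>v i = 1 - d\<close> can be read off from the distance \<open>d\<close> to the \<open>i\<close>-th set without normalization.\<close>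

definition cube :: "(nat \<Rightarrow> real) set" where
  "cube = {v. (\<forall>i. 0 \<le> v i \<and> v i \<le> 1) \<and> (\<exists>i. v i = 1) \<and> {i. v i \<noteq> 0} \<in> nerve}"

text \<open>The chosen point serves as the barycenter of \<open>\<sigma>\<close>. The level sets of
  a point \<open>v\<close> form a chain of simplices, so mixing the points chosen for them imitates
  an affine map on the barycentric subdivision of the nerve.\<close>

definition vertex :: "nat set \<Rightarrow> nat \<Rightarrow> 'a" where
  "vertex \<sigma> = (SOME z. z \<in> (\<Inter>i\<in>\<sigma>. besicovitch_saturation (C i)))"

definition level :: "(nat \<Rightarrow> real) \<Rightarrow> real \<Rightarrow> nat set" where
  "level v t = {i. 1 - v i \<le> t}"

text \<open>The sets \<open>level v t\<close> increase with \<open>t\<close> and contain all \<open>i\<close> with \<open>v i = 1\<close>, so all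
  sequences mixed here lie in the saturation of such a \<open>C i\<close>.\<close>

definition realize :: "(nat \<Rightarrow> real) \<Rightarrow> nat \<Rightarrow> 'a" where
  "realize v = (\<lambda>n. vertex (level v (phase n)) n)"

text \<open>Coordinate \<open>i\<close> falls linearly from 1 on the saturation of
  \<open>C i\<close> to 0 at distance \<open>e\<close>; with \<open>e\<close> from
  \<open>separation\<close> the support is a simplex of the nerve.\<close>

definition coords :: "real \<Rightarrow> (nat \<Rightarrow> 'a) \<Rightarrow> nat \<Rightarrow> real" where
  "coords e x = (\<lambda>i. if i < k then max 0 (1 - (1 / e) * besicovitch_setdist x (C i)) else 0)"

definition family_space :: "(nat \<Rightarrow> 'a) set" where
  "family_space = (\<Union>i<k. besicovitch_saturation (C i))"

lemma nonempty: "i < k \<Longrightarrow> C i \<noteq> {}"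
  using mixing by (auto simp: mixing_def)

lemma nerve_subset: "\<sigma> \<in> nerve \<Longrightarrow> \<tau> \<subseteq> \<sigma> \<Longrightarrow> \<tau> \<in> nerve"
  unfolding nerve_def by blast

lemma vertex_mem: "\<sigma> \<in> nerve \<Longrightarrow> i \<in> \<sigma> \<Longrightarrow> vertex \<sigma> \<in> besicovitch_saturation (C i)"
  unfolding vertex_def nerve_def using someI_ex[of "\<lambda>z. z \<in> (\<Inter>i\<in>\<sigma>. besicovitch_saturation (C i))"]
  by blast

lemma cube_zero: "v \<in> cube \<Longrightarrow> k \<le> i \<Longrightarrow> v i = 0"
  by (auto simp: cube_def nerve_def)

lemma cube_le_one: "v \<in> cube \<Longrightarrow> v i \<le> 1" and cube_nonneg: "v \<in> cube \<Longrightarrow> 0 \<le> v i"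
  by (auto simp: cube_def)

text \<open>At \<open>t = 1\<close> the level set would contain all indices, also those with
  \<open>v i = 0\<close>; the phase stays below 1.\<close>

lemma level_mem_nerve:
  assumes "v \<in> cube" "t < 1"
  shows "level v t \<in> nerve"
proof (rule nerve_subset)
  show "{i. v i \<noteq> 0} \<in> nerve" using assms(1) by (simp add: cube_def)
  show "level v t \<subseteq> {i. v i \<noteq> 0}" using assms(2) by (auto simp: level_def)
qed

text \<open>The level set changes only when the phase crosses a threshold \<open>1 - v j\<close>
  with \<open>j < k\<close>, so the changes form a null set; the thresholds of the other indices
  equal 1 and are never reached.\<close>

lemma realize_mem:
  assumes v: "v \<in> cube" "v i = 1"
  shows "realize v \<in> besicovitch_saturation (C i)"
  unfolding realize_def
proof (rule saturation_mix[where p = vertex and c = "\<lambda>n. level v (phase n)"])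
  have i: "i < k" using cube_zero[OF v(1), of i] v(2) by (cases "i < k") auto
  show "subshift (C i)" "mixing (C i)"
    using subshift mixing i by auto
  have lev: "level v (phase n) \<in> nerve" for n
    using level_mem_nerve[OF v(1) phase_less_one] .
  then have "range (\<lambda>n. level v (phase n)) \<subseteq> Pow {..<k}"
    by (auto simp: nerve_def)
  then show "finite (range (\<lambda>n. level v (phase n)))"
    by (rule finite_subset) simp
  show "vertex (level v (phase n)) \<in> besicovitch_saturation (C i)" for n
    by (rule vertex_mem[OF lev]) (use v(2) phase_nonneg in \<open>simp add: level_def\<close>)
  have "upper_density (\<Union>j\<in>{..<k}. {n. (1 - v j \<le> phase n) \<noteq> (1 - v j \<le> phase (Suc n))}) = 0"
    by (intro upper_density_zero_UN phase_crossing_density) simp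
  then show "upper_density {n. level v (phase (Suc n)) \<noteq> level v (phase n)} = 0"
  proof (rule upper_density_zero_mono, intro subsetI)
    fix n assume "n \<in> {n. level v (phase (Suc n)) \<noteq> level v (phase n)}"
    then obtain j where j: "(1 - v j \<le> phase n) \<noteq> (1 - v j \<le> phase (Suc n))"
      by (auto simp: level_def)
    have "j < k"
    proof (rule ccontr)
      assume "\<not> j < k"
      then have "v j = 0" using cube_zero[OF v(1)] by simp
      with j phase_less_one[of n] phase_less_one[of "Suc n"] show False by simp
    qed
    with j show "n \<in> (\<Union>j\<in>{..<k}. {n. (1 - v j \<le> phase n) \<noteq> (1 - v j \<le> phase (Suc n))})"
      by blast
  qed
qed

lemma realize_mem_space:
  assumes "v \<in> cube"
  shows "realize v \<in> family_space"
proof -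
  obtain i where i: "v i = 1" using assms by (auto simp: cube_def)
  then have "i < k" using cube_zero[OF assms, of i] by (cases "i < k") auto
  with realize_mem[OF assms i] show ?thesis by (auto simp: family_space_def)
qed

text \<open>The level sets of \<open>v\<close> and \<open>w\<close> differ at index \<open>n\<close>
  only if the phase lies between the thresholds \<open>1 - v i\<close> and \<open>1 - w i\<close>
  for some \<open>i\<close>.\<close>

lemma realize_dist:
  assumes "v \<in> cube" "w \<in> cube"
  shows "besicovitch_dist (realize v) (realize w) \<le> (\<Sum>i<k. 2 * \<bar>v i - w i\<bar>)"
proof -
  let ?D = "\<lambda>i. {n. min (1 - v i) (1 - w i) \<le> phase n \<and> phase n < max (1 - v i) (1 - w i)}"
  have "{n. realize v n \<noteq> realize w n} \<subseteq> (\<Union>i<k. ?D i)"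
  proof
    fix n assume "n \<in> {n. realize v n \<noteq> realize w n}"
    then have "level v (phase n) \<noteq> level w (phase n)"
      by (auto simp: realize_def)
    then obtain i where i: "(1 - v i \<le> phase n) \<noteq> (1 - w i \<le> phase n)"
      by (auto simp: level_def)
    then have "i < k"
      using cube_zero[OF assms(1), of i] cube_zero[OF assms(2), of i] by (cases "i < k") auto
    moreover have "n \<in> ?D i" using i by (auto simp: min_def max_def)
    ultimately show "n \<in> (\<Union>i<k. ?D i)" by blast
  qed
  then have "besicovitch_dist (realize v) (realize w) \<le> upper_density (\<Union>i<k. ?D i)"
    unfolding besicovitch_dist_eq by (rule upper_density_mono)
  also have "\<dots> \<le> (\<Sum>i<k. upper_density (?D i))"
    by (rule upper_density_UN) simp
  also have "\<dots> \<le> (\<Sum>i<k. 2 * \<bar>v i - w i\<bar>)"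
  proof (rule sum_mono)
    fix i
    show "upper_density (?D i) \<le> 2 * \<bar>v i - w i\<bar>"
      using phase_between_density[of "1 - v i" "1 - w i"] by (simp add: abs_minus_commute)
  qed
  finally show ?thesis .
qed

text \<open>Raising coordinate \<open>i\<close> to 1 puts the mixture into the saturation of
  \<open>C i\<close> at a cost of at most \<open>2 * (1 - v i)\<close>. If \<open>v i\<close> is
  nonzero, the support does not grow, so the raised vector stays in \<open>cube\<close>; for
  \<open>v i = 0\<close> the bound is trivial, since distances are at most 1.\<close>

lemma setdist_realize_le:
  assumes v: "v \<in> cube" and i: "i < k"
  shows "besicovitch_setdist (realize v) (C i) \<le> 2 * (1 - v i)"
proof (cases "v i = 0")
  case True
  obtain y where "y \<in> C i" using nonempty[OF i] by blast
  from besicovitch_setdist_le[OF this, of "realize v"] besicovitch_dist_le_one[of "realize v" y] True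
  show ?thesis by simp
next
  case False
  define w where "w = v(i := 1)"
  have "{j. w j \<noteq> 0} = {j. v j \<noteq> 0}"
    using False by (auto simp: w_def)
  then have w: "w \<in> cube"
    using v unfolding cube_def mem_Collect_eq by (auto simp: w_def)
  have "w i = 1" by (simp add: w_def)
  have "besicovitch_setdist (realize v) (C i) \<le> besicovitch_dist (realize v) (realize w)"
    using realize_mem[OF w \<open>w i = 1\<close>] by (rule besicovitch_setdist_saturation_le)
  also have "\<dots> \<le> (\<Sum>j<k. 2 * \<bar>v j - w j\<bar>)"
    by (rule realize_dist[OF v w])
  also have "\<dots> = (\<Sum>j<k. if j = i then 2 * (1 - v i) else 0)"
    using cube_le_one[OF v, of i] by (intro sum.cong) (auto simp: w_def)
  also have "\<dots> = 2 * (1 - v i)"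
    using i by simp
  finally show ?thesis .
qed

section \<open>From sequences to the nerve\<close>

text \<open>One \<open>e\<close> serves all of the finitely many index sets. Compactness yields a
  common point of the subshifts themselves, hence of their saturations.\<close>

lemma separation:
  obtains e where "e > 0" "\<And>x. {i. i < k \<and> besicovitch_setdist x (C i) < e} \<in> nerve"
proof -
  have "\<forall>\<sigma>\<in>Pow {..<k}. \<exists>e>0. (\<Inter>i\<in>\<sigma>. C i) = {} \<longrightarrow> (\<forall>x. \<exists>i\<in>\<sigma>. e \<le> besicovitch_setdist x (C i))"
  proof
    fix \<sigma> assume \<sigma>: "\<sigma> \<in> Pow {..<k}"
    show "\<exists>e>0. (\<Inter>i\<in>\<sigma>. C i) = {} \<longrightarrow> (\<forall>x. \<exists>i\<in>\<sigma>. e \<le> besicovitch_setdist x (C i))"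
    proof (cases "(\<Inter>i\<in>\<sigma>. C i) = {}")
      case True
      show ?thesis
        by (rule disjoint_subshifts_separated[of \<sigma> C])
           (use True \<sigma> subshift nonempty finite_subset[of \<sigma> "{..<k}"] in auto)
    qed (auto intro: exI[of _ 1])
  qed
  then obtain E where E: "\<And>\<sigma>. \<sigma> \<in> Pow {..<k} \<Longrightarrow> E \<sigma> > (0::real)"
    "\<And>\<sigma> x. \<sigma> \<in> Pow {..<k} \<Longrightarrow> (\<Inter>i\<in>\<sigma>. C i) = {} \<Longrightarrow> \<exists>i\<in>\<sigma>. E \<sigma> \<le> besicovitch_setdist x (C i)"
    by metis
  define e where "e = Min (E ` Pow {..<k})"
  have "e \<in> E ` Pow {..<k}"
    unfolding e_def by (rule Min_in) auto
  then have "e > 0" using E(1) by auto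
  moreover have "{i. i < k \<and> besicovitch_setdist x (C i) < e} \<in> nerve" (is "?\<sigma> \<in> _") for x
  proof -
    have \<sigma>: "?\<sigma> \<in> Pow {..<k}" by auto
    then have "e \<le> E ?\<sigma>"
      unfolding e_def by (intro Min_le) auto
    then have "(\<Inter>i\<in>?\<sigma>. C i) \<noteq> {}"
      using E(2)[OF \<sigma>, of x] by fastforce
    then have "(\<Inter>i\<in>?\<sigma>. besicovitch_saturation (C i)) \<noteq> {}"
      using subset_saturation by blast
    with \<sigma> show ?thesis by (simp add: nerve_def)
  qed
  ultimately show ?thesis by (rule that)
qed

lemma coords_eq_one:
  assumes "i < k" "x \<in> besicovitch_saturation (C i)"
  shows "coords e x i = 1"
proof -
  have "besicovitch_setdist x (C i) = 0"
    using besicovitch_setdist_saturation_le[OF assms(2), of x] besicovitch_setdist_nonneg[OF nonempty[OF assms(1)], of x]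
    by simp
  then show ?thesis using assms(1) by (simp add: coords_def)
qed

lemma coords_mem_cube:
  assumes e: "e > 0" "\<And>x. {i. i < k \<and> besicovitch_setdist x (C i) < e} \<in> nerve"
    and x: "x \<in> family_space"
  shows "coords e x \<in> cube"
proof -
  have "0 \<le> coords e x i \<and> coords e x i \<le> 1" for i
    using besicovitch_setdist_nonneg[OF nonempty, of i x] e(1) by (simp add: coords_def)
  moreover have "\<exists>i. coords e x i = 1"
    using x coords_eq_one by (auto simp: family_space_def)
  moreover have "{i. coords e x i \<noteq> 0} \<subseteq> {i. i < k \<and> besicovitch_setdist x (C i) < e}"
    using e(1) by (auto simp: coords_def max_def field_simps split: if_splits)
  ultimately show ?thesis
    using nerve_subset[OF e(2)] unfolding cube_def by blast
qed

lemma continuous_coords: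
  "continuous_map (subtopology besicovitch_topology family_space) euclidean (coords e)"
  unfolding euclidean_product_topology[symmetric] continuous_map_componentwise_UNIV
proof
  fix i
  show "continuous_map (subtopology besicovitch_topology family_space) euclideanreal (\<lambda>x. coords e x i)"
  proof (cases "i < k")
    case True
    then show ?thesis
      unfolding coords_def
      by (simp only: if_True)
        (intro continuous_map_real_max continuous_map_diff continuous_map_real_mult_left
          continuous_map_besicovitch_setdist nonempty continuous_map_const[THEN iffD2] disjI2; simp)
  qed (simp add: coords_def)
qed

lemma continuous_realize:
  "continuous_map (top_of_set cube) (subtopology besicovitch_topology family_space) realize"
  unfolding continuous_map_in_subtopology
proof
  show "continuous_map (top_of_set cube) besicovitch_topology realize"
  proof (rule continuous_map_into_besicovitch)
    fix v assume "v \<in> topspace (top_of_set cube)"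
    then have v: "v \<in> cube" by simp
    have "continuous_on cube (\<lambda>w. \<Sum>i<k. 2 * \<bar>v i - w i\<bar>)"
      by (intro continuous_intros continuous_on_coordinate)
    with realize_dist[OF v] show "\<exists>\<psi>. continuous_map (top_of_set cube) euclideanreal \<psi> \<and> \<psi> v = 0 \<and>
        (\<forall>w\<in>topspace (top_of_set cube). besicovitch_dist (realize v) (realize w) \<le> \<psi> w)"
      by (intro exI[of _ "\<lambda>w. \<Sum>i<k. 2 * \<bar>v i - w i\<bar>"]) simp
  qed
qed (use realize_mem_space in auto)

text \<open>A segment between two points of \<open>cube\<close> may leave it. The inequality keeps
  it inside: a coordinate where \<open>a v\<close> is 1 stays 1 along the segment, and all supports
  lie in that of \<open>b v\<close>.\<close>

lemma cube_homotopic: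
  assumes a: "continuous_on cube a" "a \<in> cube \<rightarrow> cube"
    and b: "continuous_on cube b" "b \<in> cube \<rightarrow> cube"
    and le: "\<And>v i. v \<in> cube \<Longrightarrow> a v i \<le> b v i"
  shows "homotopic_with (\<lambda>_. True) (top_of_set cube) (top_of_set cube) a b"
proof -
  let ?h = "\<lambda>(s, v) i. (1 - s) * a v i + s * b v i"
  have "continuous_on ({0..1} \<times> cube) (\<lambda>q. f (snd q) i)"
    if "continuous_on cube f" for f :: "(nat \<Rightarrow> real) \<Rightarrow> nat \<Rightarrow> real" and i
    by (rule continuous_on_compose2[of cube "\<lambda>v. f v i" _ snd])
       (use continuous_on_product_then_coordinatewise[OF that] in \<open>auto intro: continuous_on_snd\<close>)
  note cont = this[OF a(1)] this[OF b(1)]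
  have "continuous_on ({0..1} \<times> cube) ?h"
    unfolding case_prod_beta
    by (intro continuous_on_coordinatewise_then_product continuous_intros cont)
  moreover have "?h (s, v) \<in> cube" if s: "s \<in> {0..1}" and v: "v \<in> cube" for s v
  proof -
    have A: "a v \<in> cube" and B: "b v \<in> cube" using a(2) b(2) v by auto
    have pos: "0 \<le> ?h (s, v) i" for i
      using cube_nonneg[OF A, of i] cube_nonneg[OF B, of i] s by simp
    have "?h (s, v) i \<le> 1" for i
      using convex_bound_le[OF cube_le_one[OF A, of i] cube_le_one[OF B, of i], of "1 - s" s] s by simp
    moreover have "\<exists>i. ?h (s, v) i = 1"
    proof -
      obtain i where i: "a v i = 1" using A by (auto simp: cube_def)
      then have "b v i = 1"
        using le[OF v, of i] cube_le_one[OF B, of i] by simp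
      with i show ?thesis by (intro exI[of _ i]) simp
    qed
    moreover have "{i. ?h (s, v) i \<noteq> 0} \<in> nerve"
    proof (rule nerve_subset)
      show "{i. b v i \<noteq> 0} \<in> nerve" using B by (simp add: cube_def)
      show "{i. ?h (s, v) i \<noteq> 0} \<subseteq> {i. b v i \<noteq> 0}"
      proof -
        have "a v i = 0" if "b v i = 0" for i
          using le[OF v, of i] cube_nonneg[OF A, of i] that by simp
        then show ?thesis by auto
      qed
    qed
    ultimately show ?thesis using pos unfolding cube_def by blast
  qed
  ultimately show ?thesis
    unfolding homotopic_with_def
    by (intro exI[of _ ?h]) auto
qed

theorem homotopy_equivalent_cube:
  "top_of_set cube homotopy_equivalent_space subtopology besicovitch_topology family_space"
proof -
  let ?T = "subtopology besicovitch_topology family_space"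
  let ?Q = "top_of_set cube"
  obtain e where e: "e > 0" "\<And>x. {i. i < k \<and> besicovitch_setdist x (C i) < e} \<in> nerve"
    by (rule separation) blast
  let ?f = "coords e"
  have f: "continuous_map ?T ?Q ?f"
    unfolding continuous_map_in_subtopology
    using continuous_coords coords_mem_cube[OF e] by auto
  note g = continuous_realize
  have gf: "continuous_map ?T ?T (realize \<circ> ?f)"
    by (rule continuous_map_compose[OF f g])
  have "homotopic_with (\<lambda>_. True) ?T ?T id (realize \<circ> ?f)"
  proof -
    \<comment> \<open>The sequence \<open>x\<close> is overwritten from the low phases upwards.
      Since the phase lies in the half-open unit interval, nothing is overwritten at
      \<open>s = 0\<close> and everything at \<open>s = 1\<close>.\<close>
    let ?h = "\<lambda>(s, x) n. if phase n < s then realize (?f x) n else x n"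
    have mem: "?h (s, x) \<in> family_space" if x: "x \<in> family_space" for s x
    proof -
      obtain i where i: "i < k" "x \<in> besicovitch_saturation (C i)"
        using x by (auto simp: family_space_def)
      \<comment> \<open>Coordinate \<open>i\<close> of \<open>?f x\<close> is 1, so its realization
        lies in the same saturation as \<open>x\<close>; this keeps the homotopy inside
        \<open>family_space\<close>.\<close>
      have y: "realize (?f x) \<in> besicovitch_saturation (C i)"
        by (rule realize_mem[OF coords_mem_cube[OF e x] coords_eq_one[OF i]])
      have "(\<lambda>n. (if phase n < s then realize (?f x) else x) n) \<in> besicovitch_saturation (C i)"
      proof (rule saturation_mix[OF subshift[OF i(1)] mixing[OF i(1)],
            where p = "\<lambda>b. if b then realize (?f x) else x" and c = "\<lambda>n. phase n < s"])
        show "finite (range (\<lambda>n. phase n < s))"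
          by (rule finite_subset[of _ UNIV]) auto
        show "(if phase n < s then realize (?f x) else x) \<in> besicovitch_saturation (C i)" for n
          using y i(2) by simp
        show "upper_density {n. (phase (Suc n) < s) \<noteq> (phase n < s)} = 0"
          by (rule upper_density_zero_mono[OF phase_crossing_density[of s]]) auto
      qed
      moreover have "(\<lambda>n. (if phase n < s then realize (?f x) else x) n) = ?h (s, x)"
        by auto
      ultimately show ?thesis using i(1) by (auto simp: family_space_def)
    qed
    have "continuous_map (prod_topology (top_of_set {0..1}) ?T) besicovitch_topology ?h"
    proof (rule continuous_map_into_besicovitch)
      fix q assume q: "q \<in> topspace (prod_topology (top_of_set {0..1::real}) ?T)"
      obtain s x where sx: "q = (s, x)" by (cases q)
      \<comment> \<open>Two values of \<open>?h\<close> differ only where the phase lies between the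
        two thresholds, where the sequences differ, or where their images differ; there is one
        summand for each.\<close>
      let ?\<psi> = "\<lambda>r. 2 * \<bar>s - fst r\<bar> + besicovitch_dist x (snd r)
        + besicovitch_dist (realize (?f x)) ((realize \<circ> ?f) (snd r))"
      let ?P = "prod_topology (top_of_set {0..1::real}) ?T"
      have "continuous_map ?P euclideanreal fst"
        using continuous_map_fst[of "top_of_set {0..1::real}" ?T]
        by (simp add: continuous_map_in_subtopology)
      then have c1: "continuous_map ?P euclideanreal (\<lambda>r. 2 * \<bar>s - fst r\<bar>)"
        by (intro continuous_map_real_mult_left continuous_map_real_abs continuous_map_diff) auto
      have c2: "continuous_map ?P euclideanreal (\<lambda>r. besicovitch_dist x (snd r))"
        using continuous_map_compose[OF continuous_map_snd continuous_map_besicovitch_dist]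
        by (simp add: o_def)
      have c3: "continuous_map ?P euclideanreal
          (\<lambda>r. besicovitch_dist (realize (?f x)) ((realize \<circ> ?f) (snd r)))"
        using continuous_map_compose[OF continuous_map_compose[OF continuous_map_snd gf]
            continuous_map_besicovitch_dist]
        by (simp add: o_def)
      have "besicovitch_dist (?h q) (?h r) \<le> ?\<psi> r" for r
      proof -
        obtain t y where r: "r = (t, y)" by (cases r)
        have "{n. ?h q n \<noteq> ?h r n} \<subseteq>
            ({n. min s t \<le> phase n \<and> phase n < max s t} \<union> {n. x n \<noteq> y n})
              \<union> {n. realize (?f x) n \<noteq> realize (?f y) n}"
          unfolding sx r by (auto simp: min_def max_def split: if_splits)
        from upper_density_le_Un[OF this] upper_density_Un[of "{n. min s t \<le> phase n \<and> phase n < max s t}" "{n. x n \<noteq> y n}"]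
          phase_between_density[of s t]
        show ?thesis by (simp add: besicovitch_dist_eq r)
      qed
      then show "\<exists>\<psi>. continuous_map ?P euclideanreal \<psi> \<and> \<psi> q = 0 \<and>
          (\<forall>r\<in>topspace ?P. besicovitch_dist (?h q) (?h r) \<le> \<psi> r)"
        by (intro exI[of _ ?\<psi>] conjI continuous_map_add c1 c2 c3) (simp_all add: sx)
    qed
    then show ?thesis
      unfolding homotopic_with_def continuous_map_in_subtopology
      using mem by (intro exI[of _ ?h]) (auto simp: phase_nonneg[THEN leD] phase_less_one)
  qed
  then have 1: "homotopic_with (\<lambda>_. True) ?T ?T (realize \<circ> ?f) id"
    by (rule homotopic_with_symD)
  txt \<open>Both the identity and \<open>?f \<circ> realize\<close> dominate the following map coordinatewise, so that
    \<open>cube_homotopic\<close> applies to each of them.\<close>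
  define K where "K = max 1 (2 / e)"
  let ?a = "\<lambda>(v :: nat \<Rightarrow> real) i. max 0 (1 - K * (1 - v i))"
  \<comment> \<open>The factor \<open>1 / e\<close> in \<open>coords\<close> turns the distance
    bound \<open>2 * (1 - v i)\<close> into the slope \<open>2 / e\<close>, which gives the
    comparison with \<open>?f \<circ> realize\<close>; a slope of at least 1 gives the comparison
    with the identity.\<close>
  have K: "1 \<le> K" "2 / e \<le> K" by (auto simp: K_def)
  have a_le: "?a v i \<le> v i" if "v \<in> cube" for v i
    using mult_right_mono[OF K(1), of "1 - v i"] cube_nonneg[OF that, of i] cube_le_one[OF that, of i]
    by simp
  have a_mem: "?a v \<in> cube" if v: "v \<in> cube" for v
  proof -
    have "0 \<le> ?a v i \<and> ?a v i \<le> 1" for i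
      using a_le[OF v, of i] cube_le_one[OF v, of i] by auto
    moreover have "\<exists>i. ?a v i = 1"
    proof -
      obtain i where "v i = 1" using v by (auto simp: cube_def)
      then show ?thesis by (intro exI[of _ i]) simp
    qed
    moreover have "?a v i = 0" if "v i = 0" for i
      using a_le[OF v, of i] that by simp
    then have "{i. ?a v i \<noteq> 0} \<subseteq> {i. v i \<noteq> 0}"
      by blast
    then have "{i. ?a v i \<noteq> 0} \<in> nerve"
      by (rule nerve_subset[rotated]) (use v in \<open>simp add: cube_def\<close>)
    ultimately show ?thesis unfolding cube_def by blast
  qed
  have a_cont: "continuous_on cube ?a"
    by (intro continuous_on_coordinatewise_then_product continuous_intros continuous_on_coordinate)
  have fg: "continuous_map ?Q ?Q (?f \<circ> realize)"
    by (rule continuous_map_compose[OF g f])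
  have "homotopic_with (\<lambda>_. True) ?Q ?Q ?a (?f \<circ> realize)"
  proof (rule cube_homotopic[OF a_cont])
    show "?a v i \<le> (?f \<circ> realize) v i" if v: "v \<in> cube" for v i
    proof (cases "i < k")
      case True
      have "(1 / e) * besicovitch_setdist (realize v) (C i) \<le> (1 / e) * (2 * (1 - v i))"
        using setdist_realize_le[OF v True] e(1) by (intro mult_left_mono) auto
      also have "\<dots> = (2 / e) * (1 - v i)" by simp
      also have "\<dots> \<le> K * (1 - v i)"
        using K(2) cube_le_one[OF v, of i] by (intro mult_right_mono) auto
      finally show ?thesis using True by (simp add: coords_def)
    next
      case False
      then show ?thesis using cube_zero[OF v, of i] K(1) by (simp add: coords_def)
    qed
  qed (use a_mem fg in auto)
  moreover have "homotopic_with (\<lambda>_. True) ?Q ?Q ?a id"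
    by (rule cube_homotopic[OF a_cont]) (use a_mem a_le in auto)
  ultimately have 2: "homotopic_with (\<lambda>_. True) ?Q ?Q (?f \<circ> realize) id"
    using homotopic_with_trans homotopic_with_symD by blast
  show ?thesis
    unfolding homotopy_equivalent_space_def using f g 1 2 by blast
qed

end

section \<open>Geometric realization of the nerve\<close>

definition unit_vec :: "nat \<Rightarrow> nat \<Rightarrow> real" where
  "unit_vec i = (\<lambda>j. if j = i then 1 else 0)"

text \<open>The standard simplex spanned by the unit vectors of \<open>\<sigma>\<close>; for
  \<open>\<sigma> = {}\<close> it is empty, because the empty sum is not 1.\<close>

definition coordinate_simplex :: "nat set \<Rightarrow> (nat \<Rightarrow> real) set" where
  "coordinate_simplex \<sigma> = {w. (\<forall>i. 0 \<le> w i) \<and> {i. w i \<noteq> 0} \<subseteq> \<sigma> \<and> sum w \<sigma> = 1}"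

lemma sum_support:
  fixes w :: "nat \<Rightarrow> real"
  assumes "finite \<sigma>" "{i. w i \<noteq> 0} \<subseteq> \<tau>" "\<tau> \<subseteq> \<sigma>"
  shows "sum w \<tau> = sum w \<sigma>"
  using assms by (intro sum.mono_neutral_left) auto

lemma convex_coordinate_simplex: "convex (coordinate_simplex \<sigma>)"
  unfolding convex_def
proof (intro ballI allI impI)
  fix x y and u v :: real
  assume xy: "x \<in> coordinate_simplex \<sigma>" "y \<in> coordinate_simplex \<sigma>"
    and uv: "0 \<le> u" "0 \<le> v" "u + v = 1"
  have "(\<Sum>i\<in>\<sigma>. u * x i + v * y i) = u * sum x \<sigma> + v * sum y \<sigma>"
    by (simp add: sum.distrib sum_distrib_left)
  moreover have "x i = 0 \<and> y i = 0" if "i \<notin> \<sigma>" for i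
    using xy that by (auto simp: coordinate_simplex_def)
  ultimately show "u *\<^sub>R x + v *\<^sub>R y \<in> coordinate_simplex \<sigma>"
    using xy uv unfolding coordinate_simplex_def by (auto simp: scaleR_fun_def plus_fun_def)
qed

lemma unit_vec_mem: "i \<in> \<sigma> \<Longrightarrow> finite \<sigma> \<Longrightarrow> unit_vec i \<in> coordinate_simplex \<sigma>"
  by (auto simp: coordinate_simplex_def unit_vec_def)

lemma sum_fun_apply: "sum f A x = (\<Sum>a\<in>A. f a x)"
  by (induction A rule: infinite_finite_induct) auto

lemma convex_hull_unit_vecs:
  assumes "finite \<sigma>"
  shows "convex hull (unit_vec ` \<sigma>) = coordinate_simplex \<sigma>"
proof
  show "convex hull (unit_vec ` \<sigma>) \<subseteq> coordinate_simplex \<sigma>"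
    using assms by (intro hull_minimal convex_coordinate_simplex) (auto simp: unit_vec_mem)
  show "coordinate_simplex \<sigma> \<subseteq> convex hull (unit_vec ` \<sigma>)"
  proof
    fix w assume w: "w \<in> coordinate_simplex \<sigma>"
    have "w = (\<Sum>i\<in>\<sigma>. w i *\<^sub>R unit_vec i)"
    proof
      fix j
      have "(\<Sum>i\<in>\<sigma>. w i *\<^sub>R unit_vec i) j = (\<Sum>i\<in>\<sigma>. if i = j then w j else 0)"
        unfolding sum_fun_apply by (intro sum.cong) (auto simp: scaleR_fun_def unit_vec_def)
      also have "\<dots> = w j"
        using w assms by (auto simp: coordinate_simplex_def)
      finally show "w j = (\<Sum>i\<in>\<sigma>. w i *\<^sub>R unit_vec i) j" by simp
    qed
    also have "\<dots> \<in> convex hull (unit_vec ` \<sigma>)"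
      using w assms
      by (intro convex_sum) (auto simp: coordinate_simplex_def intro: hull_inc)
    finally show "w \<in> convex hull (unit_vec ` \<sigma>)" .
  qed
qed

text \<open>The other unit vectors lie in the hyperplane \<open>w i = 0\<close>, which
  \<open>unit_vec i\<close> avoids.\<close>

lemma affine_independent_unit_vecs: "\<not> affine_dependent (unit_vec ` \<sigma>)"
proof
  assume "affine_dependent (unit_vec ` \<sigma>)"
  then obtain i where i: "i \<in> \<sigma>" "unit_vec i \<in> affine hull (unit_vec ` \<sigma> - {unit_vec i})"
    by (auto simp: affine_dependent_def)
  have "affine {w :: nat \<Rightarrow> real. w i = 0}"
    by (auto simp: affine_def scaleR_fun_def plus_fun_def)
  moreover have "unit_vec ` \<sigma> - {unit_vec i} \<subseteq> {w. w i = 0}"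
    by (auto simp: unit_vec_def)
  ultimately have "affine hull (unit_vec ` \<sigma> - {unit_vec i}) \<subseteq> {w. w i = 0}"
    by (intro hull_minimal)
  with i(2) show False by (auto simp: unit_vec_def)
qed

lemma euclidean_simplex_coordinate_simplex:
  assumes "\<sigma> \<subseteq> {..<k}"
  shows "euclidean_simplex k (coordinate_simplex \<sigma>)"
  unfolding euclidean_simplex_def
proof (intro exI[of _ "unit_vec ` \<sigma>"] conjI affine_independent_unit_vecs)
  have "finite \<sigma>" using assms finite_subset by auto
  then show "finite (unit_vec ` \<sigma>)" "coordinate_simplex \<sigma> = convex hull (unit_vec ` \<sigma>)"
    by (auto simp: convex_hull_unit_vecs)
  show "unit_vec ` \<sigma> \<subseteq> topspace (Euclidean_space k)"
    using assms by (auto simp: topspace_Euclidean_space unit_vec_def)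
qed

text \<open>A coordinate that vanishes at an inner point of a segment between nonnegative vectors
  vanishes at both ends.\<close>

lemma coordinate_simplex_face:
  assumes "finite \<sigma>" "\<tau> \<subseteq> \<sigma>"
  shows "coordinate_simplex \<tau> face_of coordinate_simplex \<sigma>"
  unfolding face_of_def
proof (intro conjI convex_coordinate_simplex ballI impI)
  show "coordinate_simplex \<tau> \<subseteq> coordinate_simplex \<sigma>"
    using assms sum_support[OF assms(1) _ assms(2)] by (fastforce simp: coordinate_simplex_def)
next
  fix a b x
  assume ab: "a \<in> coordinate_simplex \<sigma>" "b \<in> coordinate_simplex \<sigma>"
    and x: "x \<in> coordinate_simplex \<tau>" "x \<in> open_segment a b"
  obtain u where u: "0 < u" "u < 1" "x = (1 - u) *\<^sub>R a + u *\<^sub>R b"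
    using x(2) by (auto simp: in_segment)
  have "a i = 0 \<and> b i = 0" if "i \<notin> \<tau>" for i
  proof -
    have "(1 - u) * a i + u * b i = 0"
      using x(1) that u(3) by (auto simp: coordinate_simplex_def scaleR_fun_def plus_fun_def)
    moreover have "0 \<le> a i" "0 \<le> b i"
      using ab by (auto simp: coordinate_simplex_def)
    ultimately have "(1 - u) * a i = 0" "u * b i = 0"
      using u(1,2) by (simp_all add: add_nonneg_eq_0_iff)
    with u(1,2) show ?thesis by auto
  qed
  then have "{i. a i \<noteq> 0} \<subseteq> \<tau>" "{i. b i \<noteq> 0} \<subseteq> \<tau>" by blast+
  with ab sum_support[OF assms(1) _ assms(2)]
  show "a \<in> coordinate_simplex \<tau>" "b \<in> coordinate_simplex \<tau>"
    by (auto simp: coordinate_simplex_def)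
qed

text \<open>\<open>\<tau>\<close> collects the supports of all points of \<open>F\<close>. A point
  of \<open>F\<close> with positive coordinate \<open>i\<close>, if it is not the vertex
  \<open>unit_vec i\<close>, lies strictly between this vertex and the opposite face; so the vertex
  belongs to \<open>F\<close>, and convexity does the rest.\<close>

lemma face_of_coordinate_simplex:
  assumes fin: "finite \<sigma>" and F: "F face_of coordinate_simplex \<sigma>"
  obtains \<tau> where "\<tau> \<subseteq> \<sigma>" "F = coordinate_simplex \<tau>"
proof
  define \<tau> where "\<tau> = {i. \<exists>w\<in>F. w i \<noteq> 0}"
  have sub: "F \<subseteq> coordinate_simplex \<sigma>" and conv: "convex F"
    and face: "\<And>a b x. a \<in> coordinate_simplex \<sigma> \<Longrightarrow> b \<in> coordinate_simplex \<sigma> \<Longrightarrow> x \<in> F \<Longrightarrow>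
      x \<in> open_segment a b \<Longrightarrow> a \<in> F"
    using F unfolding face_of_def by blast+
  show \<tau>\<sigma>: "\<tau> \<subseteq> \<sigma>"
    using sub by (auto simp: \<tau>_def coordinate_simplex_def)
  have "finite \<tau>" using \<tau>\<sigma> fin finite_subset by blast
  have unit: "unit_vec i \<in> F" if i\<tau>: "i \<in> \<tau>" for i
  proof -
    obtain w where w: "w \<in> F" "w i \<noteq> 0" using i\<tau> by (auto simp: \<tau>_def)
    then have w': "w \<in> coordinate_simplex \<sigma>" using sub by blast
    then have "0 < w i" using w(2) by (auto simp: coordinate_simplex_def less_le)
    have i: "i \<in> \<sigma>" using i\<tau> \<tau>\<sigma> by blast
    have sum_rest: "w i + sum w (\<sigma> - {i}) = 1"
      using w' i fin by (simp add: coordinate_simplex_def sum.remove)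
    show ?thesis
    proof (cases "w i = 1")
      case True
      with sum_rest have "sum w (\<sigma> - {i}) = 0" by simp
      then have "w j = 0" if "j \<in> \<sigma> - {i}" for j
        using that w' fin by (simp add: sum_nonneg_eq_0_iff coordinate_simplex_def)
      then have "w j = unit_vec i j" for j
        using True w' by (cases "j \<in> \<sigma>") (auto simp: unit_vec_def coordinate_simplex_def)
      then have "w = unit_vec i" ..
      with w(1) show ?thesis by simp
    next
      case False
      have "0 \<le> sum w (\<sigma> - {i})"
        using w' by (intro sum_nonneg) (simp add: coordinate_simplex_def)
      with sum_rest False have lt: "w i < 1" by simp
      \<comment> \<open>The projection of \<open>w\<close> from the vertex \<open>unit_vec i\<close>
        to the opposite face.\<close>
      define b where "b = (\<lambda>j. if j = i then 0 else w j / (1 - w i))"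
      have "sum b \<sigma> = sum b (\<sigma> - {i})"
        using i fin by (simp add: sum.remove b_def)
      also have "\<dots> = (\<Sum>j\<in>\<sigma> - {i}. w j / (1 - w i))"
        by (intro sum.cong) (auto simp: b_def)
      also have "\<dots> = 1"
        using sum_rest lt by (simp add: flip: sum_divide_distrib)
      finally have "b \<in> coordinate_simplex \<sigma>"
        using w' lt by (auto simp: coordinate_simplex_def b_def)
      moreover have "w = (1 - (1 - w i)) *\<^sub>R unit_vec i + (1 - w i) *\<^sub>R b"
        using lt by (auto simp: fun_eq_iff scaleR_fun_def plus_fun_def unit_vec_def b_def)
      moreover have "unit_vec i \<noteq> b"
        by (auto simp: unit_vec_def b_def fun_eq_iff)
      ultimately show ?thesis
        using face[OF unit_vec_mem[OF i fin] _ w(1), of b] \<open>0 < w i\<close> lt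
        unfolding in_segment by (metis diff_gt_0_iff_gt diff_less_eq less_add_same_cancel1)
    qed
  qed
  show "F = coordinate_simplex \<tau>"
  proof
    show "F \<subseteq> coordinate_simplex \<tau>"
    proof
      fix w assume "w \<in> F"
      then have "w \<in> coordinate_simplex \<sigma>" "{i. w i \<noteq> 0} \<subseteq> \<tau>"
        using sub by (auto simp: \<tau>_def)
      with sum_support[OF fin _ \<tau>\<sigma>] show "w \<in> coordinate_simplex \<tau>"
        by (auto simp: coordinate_simplex_def)
    qed
    show "coordinate_simplex \<tau> \<subseteq> F"
      unfolding convex_hull_unit_vecs[OF \<open>finite \<tau>\<close>, symmetric]
      using unit conv by (intro hull_minimal) auto
  qed
qed

lemma coordinate_simplex_Int:
  assumes "finite \<sigma>" "finite \<sigma>'"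
  shows "coordinate_simplex \<sigma> \<inter> coordinate_simplex \<sigma>' = coordinate_simplex (\<sigma> \<inter> \<sigma>')"
proof
  show "coordinate_simplex \<sigma> \<inter> coordinate_simplex \<sigma>' \<subseteq> coordinate_simplex (\<sigma> \<inter> \<sigma>')"
    using sum_support[OF assms(1), of _ "\<sigma> \<inter> \<sigma>'"] by (auto simp: coordinate_simplex_def)
  show "coordinate_simplex (\<sigma> \<inter> \<sigma>') \<subseteq> coordinate_simplex \<sigma> \<inter> coordinate_simplex \<sigma>'"
    using coordinate_simplex_face[OF assms(1), of "\<sigma> \<inter> \<sigma>'"]
      coordinate_simplex_face[OF assms(2), of "\<sigma> \<inter> \<sigma>'"] by (auto dest!: face_of_imp_subset)
qed

lemma euclidean_simplicial_complex_coordinate_simplices: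
  assumes N: "N \<subseteq> Pow {..<k}" "\<And>\<sigma> \<tau>. \<sigma> \<in> N \<Longrightarrow> \<tau> \<subseteq> \<sigma> \<Longrightarrow> \<tau> \<in> N"
  shows "euclidean_simplicial_complex k (coordinate_simplex ` N)"
proof -
  have fin: "finite \<sigma>" if "\<sigma> \<in> N" for \<sigma>
    using N(1) that finite_subset[of \<sigma> "{..<k}"] by auto
  show ?thesis
    unfolding euclidean_simplicial_complex_def
  proof (intro conjI ballI allI impI)
    fix S assume "S \<in> coordinate_simplex ` N"
    then show "euclidean_simplex k S"
      using N(1) by (auto intro!: euclidean_simplex_coordinate_simplex)
  next
    fix F S assume FS: "S \<in> coordinate_simplex ` N \<and> F face_of S"
    then obtain \<sigma> where \<sigma>: "\<sigma> \<in> N" "S = coordinate_simplex \<sigma>" by blast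
    with FS obtain \<tau> where "\<tau> \<subseteq> \<sigma>" "F = coordinate_simplex \<tau>"
      using face_of_coordinate_simplex[OF fin] by metis
    with N(2) \<sigma>(1) show "F \<in> coordinate_simplex ` N" by blast
  next
    fix S S' assume "S \<in> coordinate_simplex ` N \<and> S' \<in> coordinate_simplex ` N"
    then obtain \<sigma> \<sigma>' where \<sigma>: "\<sigma> \<in> N" "\<sigma>' \<in> N"
      and S: "S = coordinate_simplex \<sigma>" "S' = coordinate_simplex \<sigma>'" by blast
    show "(S \<inter> S') face_of S" "(S \<inter> S') face_of S'"
      unfolding S coordinate_simplex_Int[OF fin[OF \<sigma>(1)] fin[OF \<sigma>(2)]]
      by (intro coordinate_simplex_face fin \<sigma> Int_lower1 Int_lower2)+
  qed
qed

text \<open>The inserted 0 makes the maximum meaningful for \<open>k = 0\<close>, where the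
  induction starts.\<close>

lemma continuous_on_Max_coordinates:
  "continuous_on S (\<lambda>w :: nat \<Rightarrow> real. Max (insert 0 (w ` {..<k})))"
proof (induction k)
  case (Suc k)
  have "Max (insert 0 (w ` {..<Suc k})) = max (w k) (Max (insert 0 (w ` {..<k})))" for w :: "nat \<Rightarrow> real"
    by (simp add: lessThan_Suc insert_commute[of 0])
  with Suc show ?case
    by (auto intro!: continuous_on_max continuous_on_coordinate)
qed simp

context mixing_family
begin

text \<open>Both sets meet each ray from the origin at most once, one being normalized by the sum of
  the coordinates and the other by their maximum; rescaling along the rays preserves
  supports.\<close>

lemma homeomorphic_cube:
  defines "P \<equiv> \<Union> (coordinate_simplex ` nerve)"
  shows "top_of_set P homeomorphic_space top_of_set cube"
proof -
  define M where "M w = Max (insert 0 (w ` {..<k}))" for w :: "nat \<Rightarrow> real"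
  define f where "f w = (\<lambda>i. w i / M w)" for w :: "nat \<Rightarrow> real"
  define g where "g v = (\<lambda>i. v i / sum v {..<k})" for v :: "nat \<Rightarrow> real"
  have P_iff: "w \<in> P \<longleftrightarrow> (\<forall>i. 0 \<le> w i) \<and> {i. w i \<noteq> 0} \<in> nerve \<and> sum w {..<k} = 1" for w
  proof
    assume "w \<in> P"
    then obtain \<sigma> where \<sigma>: "\<sigma> \<in> nerve" "w \<in> coordinate_simplex \<sigma>" by (auto simp: P_def)
    then have "sum w \<sigma> = sum w {..<k}"
      by (intro sum_support) (auto simp: coordinate_simplex_def nerve_def)
    with \<sigma> nerve_subset show "(\<forall>i. 0 \<le> w i) \<and> {i. w i \<noteq> 0} \<in> nerve \<and> sum w {..<k} = 1"
      by (auto simp: coordinate_simplex_def)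
  next
    assume w: "(\<forall>i. 0 \<le> w i) \<and> {i. w i \<noteq> 0} \<in> nerve \<and> sum w {..<k} = 1"
    then have "sum w {i. w i \<noteq> 0} = sum w {..<k}"
      by (intro sum_support) (auto simp: nerve_def)
    with w have "w \<in> coordinate_simplex {i. w i \<noteq> 0}"
      by (simp add: coordinate_simplex_def)
    with w show "w \<in> P" by (auto simp: P_def)
  qed
  have P_zero: "w i = 0" if "w \<in> P" "k \<le> i" for w i
    using that unfolding P_iff nerve_def by force
  have M_pos: "0 < M w" if "w \<in> P" for w
  proof (rule ccontr)
    assume "\<not> 0 < M w"
    then have "w i \<le> 0" if "i < k" for i
      using that by (auto simp: M_def not_less)
    then have "sum w {..<k} \<le> 0" by (intro sum_nonpos) auto
    with that show False by (simp add: P_iff)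
  qed
  have M_ge: "w i \<le> M w" if "w \<in> P" for w i
  proof (cases "i < k")
    case True
    then show ?thesis unfolding M_def by (intro Max_ge) auto
  qed (use P_zero[OF that, of i] M_pos[OF that] in simp)
  have M_attained: "\<exists>i. w i = M w" if "w \<in> P" for w
  proof -
    have "M w \<in> insert 0 (w ` {..<k})"
      unfolding M_def by (rule Max_in) auto
    with M_pos[OF that] show ?thesis by auto
  qed
  have cube_one: "\<exists>i<k. v i = 1" if v: "v \<in> cube" for v
  proof -
    obtain i where "v i = 1" using v by (auto simp: cube_def)
    with cube_zero[OF v, of i] show ?thesis by (intro exI[of _ i]) (cases "i < k"; simp)
  qed
  have sum_pos: "0 < sum v {..<k}" if v: "v \<in> cube" for v
  proof -
    obtain i where "i < k" "v i = 1" using cube_one[OF v] by blast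
    then show ?thesis using cube_nonneg[OF v] by (intro sum_pos2[of _ i]) auto
  qed
  have f_mem: "f w \<in> cube" if w: "w \<in> P" for w
  proof -
    have "{i. f w i \<noteq> 0} = {i. w i \<noteq> 0}"
      using M_pos[OF w] by (auto simp: f_def)
    moreover have "0 \<le> f w i \<and> f w i \<le> 1" for i
      using w M_pos[OF w] M_ge[OF w, of i] by (simp add: f_def P_iff)
    moreover have "f w i = 1" if "w i = M w" for i
      using that M_pos[OF w] by (simp add: f_def)
    then have "\<exists>i. f w i = 1"
      using M_attained[OF w] by blast
    ultimately show ?thesis using w by (simp add: cube_def P_iff)
  qed
  have g_mem: "g v \<in> P" if v: "v \<in> cube" for v
  proof -
    have "{i. g v i \<noteq> 0} = {i. v i \<noteq> 0}"
      using sum_pos[OF v] by (auto simp: g_def)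
    moreover have "sum (g v) {..<k} = 1"
      using sum_pos[OF v] by (simp add: g_def flip: sum_divide_distrib)
    moreover have "0 \<le> g v i" for i
      using sum_pos[OF v] cube_nonneg[OF v, of i] by (simp add: g_def)
    ultimately show ?thesis using v by (simp add: cube_def P_iff)
  qed
  have gf: "g (f w) = w" if w: "w \<in> P" for w
  proof
    fix i
    have "sum (f w) {..<k} = 1 / M w"
      using w by (simp add: f_def P_iff flip: sum_divide_distrib)
    then show "g (f w) i = w i"
      using M_pos[OF w] by (simp add: g_def) (simp add: f_def)
  qed
  have fg: "f (g v) = v" if v: "v \<in> cube" for v
  proof
    fix i
    obtain j where j: "j < k" "v j = 1" using cube_one[OF v] by blast
    have "M (g v) = 1 / sum v {..<k}"
      unfolding M_def
    proof (rule Max_eqI)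
      show "1 / sum v {..<k} \<in> insert 0 (g v ` {..<k})"
        using j by (intro insertI2 image_eqI[of _ _ j]) (auto simp: g_def)
      show "y \<le> 1 / sum v {..<k}" if "y \<in> insert 0 (g v ` {..<k})" for y
        using that sum_pos[OF v] cube_le_one[OF v] by (auto simp: g_def divide_right_mono)
    qed simp
    then show "f (g v) i = v i"
      using sum_pos[OF v] by (simp add: f_def) (simp add: g_def)
  qed
  have "\<forall>w\<in>P. M w \<noteq> 0"
    using M_pos by (metis less_irrefl)
  then have "continuous_on P f"
    unfolding f_def M_def
    by (intro continuous_on_coordinatewise_then_product continuous_on_divide
        continuous_on_coordinate continuous_on_Max_coordinates)
  moreover have "continuous_on cube g"
    unfolding g_def using sum_pos
    by (intro continuous_on_coordinatewise_then_product continuous_on_divide continuous_on_sum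
        continuous_on_coordinate) fastforce
  ultimately show ?thesis
    unfolding homeomorphic_space_def homeomorphic_maps_def
    using f_mem g_mem fg gf by (intro exI[of _ f] exI[of _ g]) auto
qed

theorem homotopy_equivalent_complex:
  "\<exists>n K. finite K \<and> euclidean_simplicial_complex n K \<and>
    polyhedron_space n K homotopy_equivalent_space subtopology besicovitch_topology family_space"
proof (intro exI[of _ k] exI[of _ "coordinate_simplex ` nerve"] conjI)
  have N: "nerve \<subseteq> Pow {..<k}" by (auto simp: nerve_def)
  then show "finite (coordinate_simplex ` nerve)"
    by (intro finite_imageI finite_subset[OF N]) simp
  show "euclidean_simplicial_complex k (coordinate_simplex ` nerve)"
    using N nerve_subset by (rule euclidean_simplicial_complex_coordinate_simplices)
  have "\<Union> (coordinate_simplex ` nerve) \<subseteq> {x. \<forall>i\<ge>k. x i = 0}"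
    using N by (force simp: coordinate_simplex_def)
  then have "polyhedron_space k (coordinate_simplex ` nerve) = top_of_set (\<Union> (coordinate_simplex ` nerve))"
    by (simp add: polyhedron_space_def Euclidean_space_def subtopology_subtopology
        euclidean_product_topology Int_absorb1)
  then show "polyhedron_space k (coordinate_simplex ` nerve) homotopy_equivalent_space
      subtopology besicovitch_topology family_space"
    using homotopy_eqv_trans[OF homeomorphic_imp_homotopy_equivalent_space[OF homeomorphic_cube]
        homotopy_equivalent_cube] by simp
qed

end

section \<open>Transitive components of sofic shifts\<close>

fun graph_path :: "('v \<times> 'a \<times> 'v) set \<Rightarrow> 'v \<Rightarrow> 'a list \<Rightarrow> 'v \<Rightarrow> bool" where
  "graph_path E p [] q \<longleftrightarrow> p = q"
| "graph_path E p (s # w) q \<longleftrightarrow> (\<exists>r. (p, s, r) \<in> E \<and> graph_path E r w q)"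

definition infinite_path :: "('v \<times> 'a \<times> 'v) set \<Rightarrow> 'v \<Rightarrow> (nat \<Rightarrow> 'a) \<Rightarrow> bool" where
  "infinite_path E p x \<longleftrightarrow> (\<exists>v. v 0 = p \<and> (\<forall>i. (v i, x i, v (Suc i)) \<in> E))"

definition edge_rel :: "('v \<times> 'a \<times> 'v) set \<Rightarrow> ('v \<times> 'v) set" where
  "edge_rel E = {(p, q). \<exists>s. (p, s, q) \<in> E}"

text \<open>These are the edges of the strongly connected component of \<open>a\<close>; there are
  none if \<open>a\<close> lies on no cycle.\<close>

definition component_edges :: "('v \<times> 'a \<times> 'v) set \<Rightarrow> 'v \<Rightarrow> ('v \<times> 'a \<times> 'v) set" where
  "component_edges E a =
    {(p, s, q). (p, s, q) \<in> E \<and> (a, p) \<in> (edge_rel E)\<^sup>* \<and> (q, a) \<in> (edge_rel E)\<^sup>*}"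

lemma mem_presented_shift: "x \<in> presented_shift E \<longleftrightarrow> (\<exists>p. infinite_path E p x)"
  by (auto simp: presented_shift_def infinite_path_def)

lemma component_edges_subset: "component_edges E a \<subseteq> E"
  by (auto simp: component_edges_def)

lemma finite_component_edges: "finite E \<Longrightarrow> finite (component_edges E a)"
  by (rule finite_subset[OF component_edges_subset])

lemma presented_shift_mono: "E \<subseteq> F \<Longrightarrow> presented_shift E \<subseteq> presented_shift F"
  unfolding presented_shift_def by blast

lemma edge_relI: "(p, s, q) \<in> E \<Longrightarrow> (p, q) \<in> edge_rel E"
  by (auto simp: edge_rel_def)

lemma finite_edge_rel:
  assumes "finite E"
  shows "finite (edge_rel E)"
proof -
  have "edge_rel E = (\<lambda>(p, s, q). (p, q)) ` E"
    by (force simp: edge_rel_def)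
  with assms show ?thesis by simp
qed

lemma path_append: "graph_path E p (u @ w) q \<longleftrightarrow> (\<exists>r. graph_path E p u r \<and> graph_path E r w q)"
  by (induction u arbitrary: p) auto

lemma path_reachable: "graph_path E p w q \<Longrightarrow> (p, q) \<in> (edge_rel E)\<^sup>*"
  by (induction w arbitrary: p) (auto intro: converse_rtrancl_into_rtrancl edge_relI)

lemma path_reachable_trancl: "graph_path E p w q \<Longrightarrow> w \<noteq> [] \<Longrightarrow> (p, q) \<in> (edge_rel E)\<^sup>+"
  by (cases w) (auto intro: rtrancl_into_trancl2 edge_relI path_reachable)

lemma path_of_vertices:
  "(\<And>i. i < length w \<Longrightarrow> (v i, w ! i, v (Suc i)) \<in> E) \<Longrightarrow> graph_path E (v 0) w (v (length w))"
proof (induction w arbitrary: v)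
  case (Cons s w)
  have "graph_path E (v (Suc 0)) w (v (Suc (length w)))"
    using Cons.IH[of "\<lambda>i. v (Suc i)"] Cons.prems[of "Suc _"] by simp
  then show ?case using Cons.prems[of 0] by auto
qed simp

lemma path_component:
  assumes "graph_path E p w q" "(a, p) \<in> (edge_rel E)\<^sup>*" "(q, a) \<in> (edge_rel E)\<^sup>*"
  shows "graph_path (component_edges E a) p w q"
  using assms
proof (induction w arbitrary: p)
  case (Cons s w)
  then obtain r where r: "(p, s, r) \<in> E" "graph_path E r w q" by auto
  then have "(a, r) \<in> (edge_rel E)\<^sup>*"
    using Cons.prems(2) edge_relI rtrancl.rtrancl_into_rtrancl by metis
  moreover have "(r, a) \<in> (edge_rel E)\<^sup>*"
    using path_reachable[OF r(2)] Cons.prems(3) by (rule rtrancl_trans)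
  ultimately show ?case
    using r Cons.IH[OF r(2)] Cons.prems by (auto simp: component_edges_def)
qed simp

lemma path_of_reachable: "(p, q) \<in> (edge_rel E)\<^sup>* \<Longrightarrow> \<exists>w. graph_path E p w q"
proof (induction rule: converse_rtrancl_induct)
  case base
  then show ?case by (intro exI[of _ "[]"]) simp
next
  case (step p r)
  then obtain s w where "(p, s, r) \<in> E" "graph_path E r w q"
    by (auto simp: edge_rel_def)
  then have "graph_path E p (s # w) q" by auto
  then show ?case ..
qed

lemma infinite_path_Cons:
  assumes "(p, s, q) \<in> E" "infinite_path E q x"
  shows "infinite_path E p (case_nat s x)"
proof -
  obtain v where "v 0 = q" "\<And>i. (v i, x i, v (Suc i)) \<in> E"
    using assms(2) by (auto simp: infinite_path_def)
  with assms(1) show ?thesis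
    unfolding infinite_path_def
    by (intro exI[of _ "case_nat p v"]) (auto split: nat.split)
qed

lemma infinite_path_prepend:
  "graph_path E p w q \<Longrightarrow> infinite_path E q x \<Longrightarrow>
    infinite_path E p (\<lambda>i. if i < length w then w ! i else x (i - length w))"
proof (induction w arbitrary: p)
  case (Cons s w)
  then obtain r where r: "(p, s, r) \<in> E" "graph_path E r w q" by auto
  have "(\<lambda>i. if i < length (s # w) then (s # w) ! i else x (i - length (s # w))) =
    case_nat s (\<lambda>i. if i < length w then w ! i else x (i - length w))"
    by (auto simp: fun_eq_iff split: nat.split)
  with infinite_path_Cons[OF r(1) Cons.IH[OF r(2) Cons.prems(2)]] show ?case by simp
qed simp

lemma infinite_path_edge: "infinite_path E p x \<Longrightarrow> \<exists>q. (p, x 0, q) \<in> E"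
  unfolding infinite_path_def by blast

text \<open>The infinite continuation matters because the graph may have vertices without outgoing
  edges.\<close>

lemma words_presented_shift_iff:
  "w \<in> words (presented_shift E) \<longleftrightarrow> (\<exists>p q x. graph_path E p w q \<and> infinite_path E q x)"
proof
  assume "w \<in> words (presented_shift E)"
  then obtain x i where x: "x \<in> presented_shift E" "w = map x [i..<i + length w]"
    by (auto simp: words_def)
  then obtain v where v: "\<And>i. (v i, x i, v (Suc i)) \<in> E"
    by (auto simp: presented_shift_def)
  have nth: "w ! j = x (i + j)" if "j < length w" for j
  proof -
    have "w ! j = map x [i..<i + length w] ! j" using x(2) by simp
    with that show ?thesis by simp
  qed
  have "graph_path E (v (i + 0)) w (v (i + length w))"
    by (rule path_of_vertices[of w "\<lambda>j. v (i + j)"]) (use nth v[of "i + _"] in simp)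
  moreover have "infinite_path E (v (i + length w)) (\<lambda>j. x (i + length w + j))"
    unfolding infinite_path_def
    by (intro exI[of _ "\<lambda>j. v (i + length w + j)"]) (use v[of "i + length w + _"] in simp)
  ultimately show "\<exists>p q x. graph_path E p w q \<and> infinite_path E q x" by blast
next
  assume "\<exists>p q x. graph_path E p w q \<and> infinite_path E q x"
  then obtain p q x where "graph_path E p w q" "infinite_path E q x" by blast
  from infinite_path_prepend[OF this]
  have y: "(\<lambda>i. if i < length w then w ! i else x (i - length w)) \<in> presented_shift E"
    (is "?y \<in> _")
    by (auto simp: mem_presented_shift)
  have "w = map ?y [0..<0 + length w]"
    by (intro nth_equalityI) auto
  with y show "w \<in> words (presented_shift E)"
    unfolding words_def by blast
qed

section \<open>Closedness of presented shifts\<close>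

text \<open>The pigeonhole step of Koenig's lemma: if each \<open>p\<close> failed from some
  \<open>F p\<close> on, all of them would fail at \<open>sum F A\<close>, which bounds every
  \<open>F p\<close>.\<close>

lemma finite_uniform_witness:
  fixes Q :: "'b \<Rightarrow> nat \<Rightarrow> bool"
  assumes "finite A" "\<And>N. \<exists>p\<in>A. Q p N" "\<And>p M N. N \<le> M \<Longrightarrow> Q p M \<Longrightarrow> Q p N"
  shows "\<exists>p\<in>A. \<forall>N. Q p N"
proof (rule ccontr)
  assume "\<not> ?thesis"
  then obtain F where F: "\<And>p. p \<in> A \<Longrightarrow> \<not> Q p (F p)" by metis
  obtain p where p: "p \<in> A" "Q p (sum F A)" using assms(2) by blast
  have "F p \<le> sum F A" using assms(1) p(1) by (intro member_le_sum) auto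
  with assms(3) p F show False by blast
qed

text \<open>Closedness is Koenig's lemma for the paths that read prefixes of the limit
  \<open>y\<close>.\<close>

lemma subshift_presented_shift:
  fixes E :: "('v \<times> 'a \<times> 'v) set"
  assumes fin: "finite E"
  shows "subshift (presented_shift E)"
  unfolding subshift_def
proof
  show "shift ` presented_shift E \<subseteq> presented_shift E"
  proof
    fix y assume "y \<in> shift ` presented_shift E"
    then obtain x v where "y = shift x" "\<And>i. (v i, x i, v (Suc i)) \<in> E"
      by (auto simp: presented_shift_def)
    then show "y \<in> presented_shift E"
      unfolding presented_shift_def by (auto simp: shift_def intro!: exI[of _ "\<lambda>i. v (Suc i)"])
  qed
  show "closedin cantor_topology (presented_shift E)"
    unfolding closedin_cantor_iff
  proof (intro allI impI)
    fix y assume y: "\<forall>n. \<exists>x\<in>presented_shift E. \<forall>i<n. x i = y i"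
    \<comment> \<open>The infinite path runs through vertices \<open>p\<close> for which
      \<open>trace n p N\<close> holds for all \<open>N\<close>; each of them has a successor of
      this kind.\<close>
    define trace where "trace n p N \<longleftrightarrow> (\<exists>w. w 0 = p \<and> (\<forall>i<N. (w i, y (n + i), w (Suc i)) \<in> E))"
      for n and p :: 'v and N
    have trace_mono: "trace n p N" if le: "N \<le> M" and tr: "trace n p M" for n p N M
    proof -
      obtain w where "w 0 = p" "\<forall>i<M. (w i, y (n + i), w (Suc i)) \<in> E"
        using tr by (auto simp: trace_def)
      with le show ?thesis unfolding trace_def by (intro exI[of _ w]) auto
    qed
    have "\<exists>p\<in>fst ` E. \<forall>N. trace 0 p N"
    proof (rule finite_uniform_witness)
      fix N
      obtain x where x: "x \<in> presented_shift E" "\<forall>i<N. x i = y i" using y by blast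
      then obtain v where v: "\<And>i. (v i, x i, v (Suc i)) \<in> E"
        by (auto simp: presented_shift_def)
      have "v 0 \<in> fst ` E" using v[of 0] by force
      moreover have "trace 0 (v 0) N"
        unfolding trace_def using v x(2) by (intro exI[of _ v]) (metis add_0)
      ultimately show "\<exists>p\<in>fst ` E. trace 0 p N" by blast
    qed (use fin trace_mono in auto)
    moreover have "\<exists>q. (\<forall>N. trace (Suc n) q N) \<and> (p, y n, q) \<in> E" if p: "\<forall>N. trace n p N" for n p
    proof -
      have "\<exists>q\<in>{q. (p, y n, q) \<in> E}. \<forall>N. trace (Suc n) q N"
      proof (rule finite_uniform_witness)
        show "finite {q. (p, y n, q) \<in> E}"
          by (rule finite_subset[of _ "(\<lambda>(p, s, q). q) ` E"]) (use fin in force)+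
        fix N
        obtain w where w: "w 0 = p" "\<forall>i<Suc N. (w i, y (n + i), w (Suc i)) \<in> E"
          using p unfolding trace_def by blast
        have "(p, y n, w 1) \<in> E" using w by force
        moreover have "trace (Suc n) (w 1) N"
          unfolding trace_def using w(2) by (intro exI[of _ "\<lambda>i. w (Suc i)"]) force
        ultimately show "\<exists>q\<in>{q. (p, y n, q) \<in> E}. trace (Suc n) q N" by blast
      qed (use trace_mono in auto)
      then show ?thesis by blast
    qed
    ultimately have "\<exists>v. \<forall>n. (\<forall>N. trace n (v n) N) \<and> (v n, y n, v (Suc n)) \<in> E"
      by (intro dependent_nat_choice) auto
    then show "y \<in> presented_shift E"
      unfolding presented_shift_def by blast
  qed
qed

section \<open>Strongly connected components and transitive subshifts\<close>

lemma transitive_component_edges: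
  assumes "finite E" "presented_shift (component_edges E a) \<noteq> {}"
  shows "transitive_subshift (presented_shift (component_edges E a))"
  unfolding transitive_subshift_def
proof (intro conjI ballI assms(2))
  let ?C = "component_edges E a"
  show "subshift (presented_shift ?C)"
    using assms(1) by (intro subshift_presented_shift finite_component_edges)
  fix u v assume "u \<in> words (presented_shift ?C)" "v \<in> words (presented_shift ?C)"
  then obtain p q x p' q' x' where u: "graph_path ?C p u q" "infinite_path ?C q x"
    and v: "graph_path ?C p' v q'" "infinite_path ?C q' x'"
    unfolding words_presented_shift_iff by blast
  \<comment> \<open>\<open>u\<close> and \<open>v\<close> may be empty, so the end of
    \<open>u\<close> and the start of \<open>v\<close> are located in the component by means of
    edges leaving them.\<close>
  obtain r where r: "(q, x 0, r) \<in> ?C" using infinite_path_edge[OF u(2)] by blast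
  then have aq: "(a, q) \<in> (edge_rel E)\<^sup>*" and qa: "(q, a) \<in> (edge_rel E)\<^sup>*"
    by (auto simp: component_edges_def intro: converse_rtrancl_into_rtrancl edge_relI)
  obtain s r' where "(p', s, r') \<in> ?C"
    using infinite_path_edge[OF infinite_path_prepend[OF v]] by blast
  then have ap: "(a, p') \<in> (edge_rel E)\<^sup>*" and pa: "(p', a) \<in> (edge_rel E)\<^sup>*"
    by (auto simp: component_edges_def intro: converse_rtrancl_into_rtrancl edge_relI)
  obtain w where "graph_path E q w p'"
    using path_of_reachable rtrancl_trans[OF qa ap] by metis
  then have "graph_path ?C q w p'" using aq pa by (rule path_component)
  with u(1) v(1) have "graph_path ?C p (u @ w @ v) q'" by (auto simp: path_append)
  with v(2) show "\<exists>w. u @ w @ v \<in> words (presented_shift ?C)"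
    unfolding words_presented_shift_iff by blast
qed

text \<open>The cycle through \<open>a\<close> gives every vertex of the component an outgoing edge
  that stays inside.\<close>

lemma infinite_path_component:
  assumes "(a, a) \<in> (edge_rel E)\<^sup>+" "(a, p) \<in> (edge_rel E)\<^sup>*" "(p, a) \<in> (edge_rel E)\<^sup>*"
  shows "\<exists>x. infinite_path (component_edges E a) p x"
proof -
  let ?P = "\<lambda>p. (a, p) \<in> (edge_rel E)\<^sup>* \<and> (p, a) \<in> (edge_rel E)\<^sup>*"
  have "\<exists>v. \<forall>n. (?P (v n) \<and> (n = 0 \<longrightarrow> v n = p)) \<and> (\<exists>s. (v n, s, v (Suc n)) \<in> component_edges E a)"
  proof (rule dependent_nat_choice)
    fix q and n :: nat assume q: "?P q \<and> (n = 0 \<longrightarrow> q = p)"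
    then have "(q, a) \<in> (edge_rel E)\<^sup>+"
      using assms(1) by (meson rtrancl_trancl_trancl)
    then obtain r where r: "(q, r) \<in> edge_rel E" "(r, a) \<in> (edge_rel E)\<^sup>*"
      by (blast dest: tranclD)
    then obtain s where "(q, s, r) \<in> E" by (auto simp: edge_rel_def)
    with q r have "(q, s, r) \<in> component_edges E a" by (auto simp: component_edges_def)
    moreover have "(a, r) \<in> (edge_rel E)\<^sup>*"
      using q r(1) rtrancl.rtrancl_into_rtrancl by metis
    ultimately show "\<exists>r. (?P r \<and> (Suc n = 0 \<longrightarrow> r = p)) \<and> (\<exists>s. (q, s, r) \<in> component_edges E a)"
      using r(2) by blast
  qed (use assms in auto)
  then obtain v where v: "v 0 = p" "\<forall>n. \<exists>s. (v n, s, v (Suc n)) \<in> component_edges E a"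
    by blast
  then obtain x where "\<forall>n. (v n, x n, v (Suc n)) \<in> component_edges E a" by metis
  with v(1) show ?thesis unfolding infinite_path_def by blast
qed

lemma upper_density_finite:
  assumes "finite A"
  shows "upper_density A = 0"
proof (rule antisym[OF _ upper_density_nonneg], rule upper_density_leI_floor_log[where K = "card A"])
  fix n
  have "real (card (A \<inter> {..n})) \<le> real (card A) * 1"
    using card_mono[OF assms, of "A \<inter> {..n}"] by simp
  also have "\<dots> \<le> real (card A) * (real (floor_log (n + 1)) + 1)"
    by (intro mult_left_mono) auto
  finally show "real (card (A \<inter> {..n})) \<le> 0 * real (n + 1) + real (card A) * (real (floor_log (n + 1)) + 1)"
    by simp
qed

text \<open>An infinite path visits some vertex \<open>a\<close> infinitely often, and after a visit
  it uses only edges of the component of \<open>a\<close>. Only the finite part before that has to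
  be replaced, which does not affect the density.\<close>

lemma presented_shift_near_component:
  assumes fin: "finite E" and x: "x \<in> presented_shift E"
  obtains a y where "a \<in> fst ` E" "y \<in> presented_shift (component_edges E a)" "besicovitch_dist y x = 0"
proof -
  obtain v where v: "\<And>i. (v i, x i, v (Suc i)) \<in> E"
    using x by (auto simp: presented_shift_def)
  have "range v \<subseteq> fst ` E" using v by force
  then have "finite (range v)" using fin finite_subset by blast
  from inf_img_fin_dom[OF this infinite_UNIV_nat] obtain a where
    a: "a \<in> range v" "infinite (v -` {a})" by auto
  have later: "\<exists>n>m. v n = a" for m
    using a(2) by (auto simp: infinite_nat_iff_unbounded)
  have reach: "(v i, v j) \<in> (edge_rel E)\<^sup>*" if "i \<le> j" for i j
    using that
  proof (induction j rule: dec_induct)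
    case (step j)
    then show ?case using v[of j] by (meson edge_relI rtrancl.rtrancl_into_rtrancl)
  qed simp
  obtain n0 where n0: "v n0 = a" using a(1) by auto
  \<comment> \<open>The first \<open>n0\<close> edges are to be replaced by the \<open>n0\<close>
    edges before the visit at \<open>n1\<close>; as \<open>n1 - n0 > n0\<close>, these already
    belong to the component.\<close>
  obtain n1 where n1: "n1 > 2 * n0" "v n1 = a" using later by blast
  have C: "(v i, x i, v (Suc i)) \<in> component_edges E a" if "n0 \<le> i" for i
  proof -
    obtain n where "n > Suc i" "v n = a" using later by blast
    then have "(v (Suc i), a) \<in> (edge_rel E)\<^sup>*" using reach[of "Suc i" n] by simp
    moreover have "(a, v i) \<in> (edge_rel E)\<^sup>*" using reach[OF that] n0 by simp
    ultimately show ?thesis using v[of i] by (simp add: component_edges_def)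
  qed
  define c where "c i = (if i < n0 then n1 - n0 + i else i)" for i
  have "(v (c i), x (c i), v (Suc (c i))) \<in> component_edges E a" for i
    using n1 by (intro C) (auto simp: c_def)
  \<comment> \<open>At the seam \<open>Suc i = n0\<close> both sides equal \<open>a\<close>, since
    \<open>v n1 = a = v n0\<close>.\<close>
  moreover have "v (Suc (c i)) = v (c (Suc i))" for i
    using n0 n1 by (cases "Suc i = n0") (auto simp: c_def)
  ultimately have y: "(\<lambda>i. x (c i)) \<in> presented_shift (component_edges E a)"
    unfolding presented_shift_def by (auto intro!: exI[of _ "\<lambda>i. v (c i)"])
  have "besicovitch_dist (\<lambda>i. x (c i)) x = 0"
    unfolding besicovitch_dist_eq
    by (rule upper_density_finite, rule finite_subset[of _ "{..<n0}"]) (auto simp: c_def)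
  moreover have "a \<in> fst ` E" using a(1) \<open>range v \<subseteq> fst ` E\<close> by blast
  ultimately show ?thesis using y that by blast
qed

text \<open>Whenever a path reads a repetition of \<open>U\<close> without closing a cycle, the set of vertices
  reachable from its endpoint shrinks; this cannot happen arbitrarily often.\<close>

lemma word_on_cycle:
  assumes fin: "finite E" and sub: "D \<subseteq> presented_shift E" and trans: "transitive_subshift D"
    and U: "U \<in> words D"
  shows "\<exists>a b. graph_path E a U b \<and> (b, a) \<in> (edge_rel E)\<^sup>*"
proof -
  define reach where "reach p = (edge_rel E)\<^sup>* `` {p}" for p
  have fin_reach: "finite (reach p)" for p
    unfolding reach_def using fin by (intro finite_rtrancl_Image finite_edge_rel) auto
  have reach_mono: "reach q \<subseteq> reach p" if "(p, q) \<in> (edge_rel E)\<^sup>*" for p q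
    using that by (auto simp: reach_def intro: rtrancl_trans)
  have pump: "\<exists>W\<in>words D. \<forall>p q. graph_path E p W q \<longrightarrow>
      (\<exists>a b. graph_path E a U b \<and> (b, a) \<in> (edge_rel E)\<^sup>*) \<or> card (reach q) + n \<le> card (reach p)" for n
  proof (induction n)
    case 0
    show ?case
    proof (intro bexI[OF _ U] allI impI disjI2)
      fix p q assume "graph_path E p U q"
      then show "card (reach q) + 0 \<le> card (reach p)"
        using card_mono[OF fin_reach reach_mono[OF path_reachable]] by simp
    qed
  next
    case (Suc n)
    then obtain W where W: "W \<in> words D" "\<And>p q. graph_path E p W q \<Longrightarrow>
      (\<exists>a b. graph_path E a U b \<and> (b, a) \<in> (edge_rel E)\<^sup>*) \<or> card (reach q) + n \<le> card (reach p)"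
      by blast
    obtain w where w: "W @ w @ U \<in> words D"
      using trans W(1) U unfolding transitive_subshift_def by blast
    show ?case
    proof (intro bexI[OF _ w] allI impI)
      fix p q assume "graph_path E p (W @ w @ U) q"
      then obtain r a where r: "graph_path E p W r" "graph_path E r w a" "graph_path E a U q"
        by (auto simp: path_append)
      show "(\<exists>a b. graph_path E a U b \<and> (b, a) \<in> (edge_rel E)\<^sup>*) \<or> card (reach q) + Suc n \<le> card (reach p)"
      proof (cases "(q, a) \<in> (edge_rel E)\<^sup>*")
        case False
        then have "a \<notin> reach q" "a \<in> reach a" by (auto simp: reach_def)
        with reach_mono[OF path_reachable[OF r(3)]] have "reach q \<subset> reach a" by blast
        then have "card (reach q) < card (reach a)" by (intro psubset_card_mono fin_reach)
        also have "\<dots> \<le> card (reach r)"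
          by (intro card_mono fin_reach reach_mono path_reachable[OF r(2)])
        finally show ?thesis using W(2)[OF r(1)] by auto
      qed (use r(3) in blast)
    qed
  qed
  \<comment> \<open>Besides \<open>p\<close> itself, only vertices in
    \<open>Range (edge_rel E)\<close> are reachable from \<open>p\<close>, so a loss of
    \<open>card (Range (edge_rel E)) + 2\<close> vertices is impossible.\<close>
  obtain W where W: "W \<in> words D" "\<And>p q. graph_path E p W q \<Longrightarrow>
      (\<exists>a b. graph_path E a U b \<and> (b, a) \<in> (edge_rel E)\<^sup>*) \<or>
      card (reach q) + (card (Range (edge_rel E)) + 2) \<le> card (reach p)"
    using pump by blast
  have "W \<in> words (presented_shift E)"
    using W(1) sub unfolding words_def by blast
  then obtain p q where pq: "graph_path E p W q"
    by (auto simp: words_presented_shift_iff)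
  have "reach p \<subseteq> insert p (Range (edge_rel E))"
    by (auto simp: reach_def elim: rtranclE)
  then have "card (reach p) \<le> card (insert p (Range (edge_rel E)))"
    using finite_edge_rel[OF fin] by (intro card_mono) (auto simp: finite_Range)
  also have "\<dots> \<le> Suc (card (Range (edge_rel E)))"
    by (rule card_insert_le_m1) auto
  finally show ?thesis using W(2)[OF pq] by auto
qed

text \<open>If every component missed some word of \<open>D\<close>, transitivity would give one
  word of \<open>D\<close> containing all the missed words. It is read along a cycle, hence inside a
  single component, which therefore does not miss its own word.\<close>

lemma transitive_subshift_subset_component:
  assumes fin: "finite E" and sub: "D \<subseteq> presented_shift E" and trans: "transitive_subshift D"
  shows "\<exists>a\<in>fst ` E. D \<subseteq> presented_shift (component_edges E a)"
proof -
  let ?T = "\<lambda>a. presented_shift (component_edges E a)"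
  have D: "subshift D" "D \<noteq> {}" using trans by (auto simp: transitive_subshift_def)
  have "\<exists>a\<in>fst ` E. words D \<subseteq> words (?T a)"
  proof (rule ccontr)
    assume "\<not> ?thesis"
    then have "\<forall>a\<in>fst ` E. \<exists>u. u \<in> words D \<and> u \<notin> words (?T a)" by blast
    then obtain u where u: "\<And>a. a \<in> fst ` E \<Longrightarrow> u a \<in> words D" "\<And>a. a \<in> fst ` E \<Longrightarrow> u a \<notin> words (?T a)"
      by metis
    \<comment> \<open>A nonempty \<open>U\<close> makes the cycle through its start vertex genuine
      and gives this vertex an outgoing edge.\<close>
    have "\<exists>U\<in>words D. U \<noteq> [] \<and> (\<forall>a\<in>A. \<exists>l r. U = l @ u a @ r)" if "finite A" "A \<subseteq> fst ` E" for A
      using that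
    proof (induction A)
      case empty
      obtain x where "x \<in> D" using D(2) by blast
      from map_upt_in_words[OF this, of 0 1] show ?case by force
    next
      case (insert a A)
      then obtain U where U: "U \<in> words D" "U \<noteq> []" "\<And>b. b \<in> A \<Longrightarrow> \<exists>l r. U = l @ u b @ r"
        by blast
      obtain w where w: "U @ w @ u a \<in> words D"
        using trans U(1) u(1)[of a] insert.prems unfolding transitive_subshift_def by blast
      show ?case
      proof (intro bexI[OF _ w] conjI ballI)
        fix b assume "b \<in> insert a A"
        then consider "b = a" | "b \<in> A" by blast
        then show "\<exists>l r. U @ w @ u a = l @ u b @ r"
        proof cases
          case 1
          then show ?thesis by (intro exI[of _ "U @ w"] exI[of _ "[]"]) simp
        next
          case 2
          then obtain l r where "U = l @ u b @ r" using U(3) by blast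
          then show ?thesis by (intro exI[of _ l] exI[of _ "r @ w @ u a"]) simp
        qed
      qed (use U(2) in simp)
    qed
    from this[OF finite_imageI[OF fin] order_refl] obtain U where
      U: "U \<in> words D" "U \<noteq> []" "\<And>a. a \<in> fst ` E \<Longrightarrow> \<exists>l r. U = l @ u a @ r" by blast
    obtain a b where ab: "graph_path E a U b" "(b, a) \<in> (edge_rel E)\<^sup>*"
      using word_on_cycle[OF fin sub trans U(1)] by blast
    have aE: "a \<in> fst ` E" using ab(1) U(2) by (cases U) force+
    then obtain l r where lr: "U = l @ u a @ r" using U(3) by blast
    have "graph_path (component_edges E a) a U b"
      using ab by (intro path_component) auto
    then obtain p q where pq: "graph_path (component_edges E a) p (u a) q" "graph_path (component_edges E a) q r b"
      unfolding lr path_append by blast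
    have ab': "(a, b) \<in> (edge_rel E)\<^sup>*" "(a, a) \<in> (edge_rel E)\<^sup>+"
      using path_reachable[OF ab(1)] path_reachable_trancl[OF ab(1) U(2)] ab(2) by auto
    obtain x where "infinite_path (component_edges E a) b x"
      using infinite_path_component[OF ab'(2,1) ab(2)] by blast
    from infinite_path_prepend[OF pq(2) this] pq(1) have "u a \<in> words (?T a)"
      unfolding words_presented_shift_iff by blast
    with u(2) aE show False by blast
  qed
  then obtain a where a: "a \<in> fst ` E" "words D \<subseteq> words (?T a)" by blast
  have T: "subshift (?T a)"
    using fin by (intro subshift_presented_shift finite_component_edges)
  \<comment> \<open>Inclusion of the words passes to the sequences because \<open>?T a\<close> is
    closed.\<close>
  have "y \<in> ?T a" if y: "y \<in> D" for y
  proof -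
    have "\<exists>x\<in>?T a. \<forall>i<n. x i = y i" for n
    proof -
      have "map y [0..<n] \<in> words (?T a)"
        using a(2) map_upt_in_words[OF y] by blast
      then obtain x where "x \<in> ?T a" "\<forall>i<n. y i = x i"
        unfolding mem_words_iff[OF T] by auto
      then show ?thesis by metis
    qed
    with T show ?thesis unfolding subshift_def closedin_cantor_iff by blast
  qed
  with a(1) show ?thesis by blast
qed

text \<open>Every transitive subshift of \<open>X\<close> lies in one of the finitely many shifts
  presented by some \<open>component_edges E a\<close>, and the nonempty ones among these are
  transitive; so the components are the maximal ones among them. They need not cover
  \<open>X\<close>, but their saturations do.\<close>

lemma sofic_components:
  assumes "sofic_shift X"
  shows "finite {C. transitive_component X C}"
    and "besicovitch_saturation X = (\<Union>C\<in>{C. transitive_component X C}. besicovitch_saturation C)"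
proof -
  obtain E :: "(nat \<times> 'a \<times> nat) set" where fin: "finite E" and X: "X = presented_shift E"
    using assms by (auto simp: sofic_shift_def)
  let ?T = "\<lambda>a. presented_shift (component_edges E a)"
  have TX: "?T a \<subseteq> X" for a
    unfolding X by (intro presented_shift_mono component_edges_subset)
  have into_T: "\<exists>a\<in>fst ` E. D \<subseteq> ?T a" if "D \<subseteq> X" "transitive_subshift D" for D
    using transitive_subshift_subset_component[OF fin] that X by blast
  have trans_T: "transitive_subshift (?T a)" if "?T a \<noteq> {}" for a
    using transitive_component_edges[OF fin that] .
  have "C \<in> ?T ` fst ` E" if C: "transitive_component X C" for C
  proof -
    have "C \<subseteq> X" "transitive_subshift C" "C \<noteq> {}"
      using C by (auto simp: transitive_component_def transitive_subshift_def)
    then obtain a where a: "a \<in> fst ` E" "C \<subseteq> ?T a" using into_T by blast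
    with \<open>C \<noteq> {}\<close> have "transitive_subshift (?T a)" by (intro trans_T) auto
    with C a TX have "?T a = C" unfolding transitive_component_def by blast
    with a(1) show ?thesis by blast
  qed
  then have "{C. transitive_component X C} \<subseteq> ?T ` fst ` E" by blast
  then show "finite {C. transitive_component X C}"
    by (rule finite_subset) (intro finite_imageI fin)
  have component: "\<exists>C. transitive_component X C \<and> ?T a \<subseteq> C" if a: "a \<in> fst ` E" "?T a \<noteq> {}" for a
  proof -
    \<comment> \<open>Maximality within the finite family suffices: a larger transitive subshift
      would again lie in a member of the family.\<close>
    have "\<exists>C\<in>?T ` fst ` E. ?T a \<subseteq> C \<and> (\<forall>D\<in>?T ` fst ` E. C \<subseteq> D \<longrightarrow> C = D)"
      using fin a(1) by (intro finite_has_maximal2) auto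
    then obtain C where C: "C \<in> ?T ` fst ` E" "?T a \<subseteq> C" "\<forall>D\<in>?T ` fst ` E. C \<subseteq> D \<longrightarrow> C = D"
      by (elim bexE conjE)
    have "C \<subseteq> X" using C(1) TX by blast
    moreover have "transitive_subshift C" using C(1,2) a(2) trans_T by blast
    moreover have "D = C" if D: "D \<subseteq> X" "transitive_subshift D" "C \<subseteq> D" for D
    proof -
      obtain b where b: "b \<in> fst ` E" "D \<subseteq> ?T b" using into_T D by blast
      then have "C = ?T b" using C(3)[rule_format, of "?T b"] D(3) by blast
      with b D(3) show ?thesis by blast
    qed
    ultimately show ?thesis using C(2) unfolding transitive_component_def by blast
  qed
  show "besicovitch_saturation X = (\<Union>C\<in>{C. transitive_component X C}. besicovitch_saturation C)"
  proof
    show "besicovitch_saturation X \<subseteq> (\<Union>C\<in>{C. transitive_component X C}. besicovitch_saturation C)"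
    proof
      fix z assume "z \<in> besicovitch_saturation X"
      then obtain x where x: "x \<in> presented_shift E" "besicovitch_dist x z = 0"
        by (auto simp: mem_saturation X)
      from presented_shift_near_component[OF fin x(1)] obtain a y where
        y: "a \<in> fst ` E" "y \<in> ?T a" "besicovitch_dist y x = 0" by blast
      then obtain C where C: "transitive_component X C" "?T a \<subseteq> C" using component by blast
      have "besicovitch_dist y z = 0"
        using besicovitch_dist_triangle[of y z x] besicovitch_dist_nonneg[of y z] x(2) y(3) by simp
      with C y(2) show "z \<in> (\<Union>C\<in>{C. transitive_component X C}. besicovitch_saturation C)"
        by (auto simp: mem_saturation)
    qed
    show "(\<Union>C\<in>{C. transitive_component X C}. besicovitch_saturation C) \<subseteq> besicovitch_saturation X"
      unfolding transitive_component_def besicovitch_saturation_def by blast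
  qed
qed

theorem theorem4:
  fixes X :: "(nat \<Rightarrow> 'a::finite) set"
  assumes "sofic_shift X"
    and "\<And>C. transitive_component X C \<Longrightarrow> mixing C"
  shows "\<exists>n K. finite K \<and> euclidean_simplicial_complex n K \<and>
           polyhedron_space n K homotopy_equivalent_space
             subtopology besicovitch_topology (besicovitch_saturation X)"
proof -
  obtain C k where C: "{C. transitive_component X C} = C ` {i. i < (k :: nat)}"
    using finite_imp_nat_seg_image_inj_on[OF sofic_components(1)[OF assms(1)]] by blast
  then have comp: "transitive_component X (C i)" if "i < k" for i
    using that by blast
  interpret mixing_family C k
    using comp assms(2) by unfold_locales (auto simp: transitive_component_def transitive_subshift_def)
  have "besicovitch_saturation X = family_space"
    using C unfolding sofic_components(2)[OF assms(1)] family_space_def by auto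
  then show ?thesis using homotopy_equivalent_complex by simp
qed

end
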